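(* Let $\mathcal{M}=(K_{i(e)},w_e,p_e)_{e\in E}$ be a countable Markov system on a complete metric space $(K,d)$ which is consistent, contractive, uniformly continuous with $b<\infty$ and has a dominating Markov chain such that $c<\infty$. Then $P(\mathcal{M})$ is not empty.
   Context: Setting. $(K,d)$ is a complete metric space; $P(X)$ denotes the Borel probability measures on $X$. A countable Markov system $\mathcal{M}=(K_{i(e)},w_e,p_e)_{e\in E}$ on $K$ consists of: a set $N\subset\mathbb{N}$ with $1\in N$; a partition $(K_j)_{j\in N}$ of $K$ into non-empty Borel sets; an at most countable set $E$; a surjective map $i:E\to N$ and a map $t:E\to N$; for each $e\in E$, Borel measurable $w_e:K_{i(e)}\to K_{t(e)}$ and $p_e:K_{i(e)}\to[0,1]$ with $p_e\not\equiv 0$, such that $\sum_{e\in E,\,i(e)=j}p_e(x)=1$ for all $x\in K_j$, $j\in N$. Each $p_e$ is extended to $K$ by zero and each $w_e$ is extended to a Borel map $K\to K$ arbitrarily. For Borel $f:K\to[0,\infty)$, $Uf:=\sum_{e\in E}p_e\,f\circ w_e$; $U^*\nu(f):=\int Uf\,d\nu$ for bounded such $f$, $\nu\in P(K)$. $P(\mathcal{M}):=\{\mu\in P(K): U^*\mu=\mu\}$. $\mathcal{M}$ is contractive with contraction rate $0<a<1$ iff $\sum_{e\in E,\,i(e)=j}p_e(x)d(w_ex,w_ey)\le a\,d(x,y)$ for all $x,y\in K_j$, $j\in N$. $\mathcal{M}$ is uniformly continuous iff $w_e|_{K_{i(e)}}$ and $p_e|_{K_{i(e)}}$ are uniformly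 continuous for each $e\in E$. $\mathcal{M}$ has a dominating Markov chain iff $\xi_i:=\sum_{e\in E,\,i(e)=i}\sup_{x\in K_i}p_e(x)<\infty$ for every $i\in N$; in this case $q_{ij}:=\frac1{\xi_i}\sum_{e\in E,\,i(e)=i,\,t(e)=j}\sup_{x\in K_i}p_e(x)$ and $c:=\sum_{j\in N}\sup_{i\in N}\xi_iq_{ij}$. Code space. $\bar E:=E\cup\{\infty\}$ is the one-point compactification of discrete $E$; $w_\infty:=\mathrm{id}$, $p_\infty:=0$, $i(\infty)=t(\infty):=1$. $\bar\Sigma:=\bar E^{\mathbb{Z}}$ with the product topology; $(S\sigma)_{i-1}=\sigma_i$; $P_S(\bar\Sigma)$ is the set of $S$-invariant Borel probability measures. ${}_m[e_m,\dots,e_n]:=\{\sigma\in\bar\Sigma:\sigma_i=e_i,\ m\le i\le n\}$. $\mathcal{F}$ is the $\sigma$-algebra generated by all cylinders ${}_m[e_m,\dots,e_0]$, $m\le 0$. $\Sigma_G:=\{\sigma\in\bar\Sigma: \sigma_n\in E,\ i(\sigma_{n+1})=t(\sigma_n)\ \forall n\in\mathbb{Z}\}$. Fix $x_i\in K_i$ for each $i\in N$. $D:=\{\sigma\in\Sigma_G:\lim_{m\to-\infty}w_{\sigma_0}\circ\dots\circ w_{\sigma_m}(x_{i(\sigma_m)})\text{ exists}\}$; $F:\bar\Sigma\to K$ is this limit on $D$, and $F(\sigma):=x_{t(\sigma_0)}$ for $\sigma\notin D$. $F(\Lambda):=\Lambda\circ F^{-1}$. $b:=\sup_{i\in N}\sup_{x\in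 K_i}\sum_{e\in E,\,i(e)=i}p_e(x)\,d(w_e(x_{i(e)}),x_{t(e)})$. $T_j:=\{\sigma\in\Sigma_G:t(\sigma_0)=j\}$. $\bar p_e$ is the continuous extension of $p_e|_{K_{i(e)}}$ to $\bar K_{i(e)}$, extended by zero to $K$. $\tilde E(\mathcal{M})$ is the set of $\Lambda\in P_S(\bar\Sigma)$ with $\Lambda(D)=1$ and $E_\Lambda(1_{{}_1[e]}|\mathcal{F})=(\bar p_e\circ F)\,1_{T_{i(e)}}$ $\Lambda$-a.e. for all $e\in E$. $\mathcal{M}$ is consistent iff $F(M)\in P(\mathcal{M})$ for all $M\in\tilde E(\mathcal{M})$. *)

theory Defs
  imports "HOL-Probability.Probability"
begin

definition borel_of :: "'x topology \<Rightarrow> 'x measure" where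
  "borel_of X = sigma (topspace X) {U. openin X U}"

definition borel_probs :: "('a::topological_space) measure set" where
  "borel_probs = {\<mu>. prob_space \<mu> \<and> sets \<mu> = sets borel}"


text \<open>The metric space is the whole type \<open>'a\<close>. Only the values of \<open>wmap M e\<close> and \<open>wt M e\<close> on
  \<open>cell M (ini M e)\<close> carry meaning: the axioms constrain nothing else, \<open>prb\<close> below is the extension
  of the weights by zero, and no definition depends on how \<open>wmap M e\<close> is extended.\<close>

record ('a, 'e) markov_system =
  verts :: "nat set"
  cell :: "nat \<Rightarrow> 'a set"
  edges :: "'e set"
  ini :: "'e \<Rightarrow> nat"
  ter :: "'e \<Rightarrow> nat"
  wmap :: "'e \<Rightarrow> 'a \<Rightarrow> 'a"
  wt :: "'e \<Rightarrow> 'a \<Rightarrow> real"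

definition edges_from :: "('a, 'e) markov_system \<Rightarrow> nat \<Rightarrow> 'e set" where
  "edges_from M j = {e \<in> edges M. ini M e = j}"

definition countable_markov_system :: "('a::complete_space, 'e) markov_system \<Rightarrow> bool" where
  "countable_markov_system M \<longleftrightarrow>
     1 \<in> verts M \<and>
     (\<forall>j\<in>verts M. cell M j \<noteq> {} \<and> cell M j \<in> sets borel) \<and>
     disjoint_family_on (cell M) (verts M) \<and>
     (\<Union>j\<in>verts M. cell M j) = UNIV \<and>
     countable (edges M) \<and>
     ini M ` edges M = verts M \<and>
     ter M \<in> edges M \<rightarrow> verts M \<and>
     (\<forall>e\<in>edges M.
        wmap M e \<in> measurable (restrict_space borel (cell M (ini M e))) borel \<and>
        wmap M e \<in> cell M (ini M e) \<rightarrow> cell M (ter M e) \<and>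
        wt M e \<in> borel_measurable (restrict_space borel (cell M (ini M e))) \<and>
        wt M e \<in> cell M (ini M e) \<rightarrow> {0..1} \<and>
        (\<exists>x\<in>cell M (ini M e). wt M e x \<noteq> 0)) \<and>
     (\<forall>j\<in>verts M. \<forall>x\<in>cell M j. ((\<lambda>e. wt M e x) has_sum 1) (edges_from M j))"

definition prb :: "('a, 'e) markov_system \<Rightarrow> 'e \<Rightarrow> 'a \<Rightarrow> real" where
  "prb M e x = (if x \<in> cell M (ini M e) then wt M e x else 0)"


text \<open>Sums and suprema of nonnegative quantities that may diverge are taken in \<open>ennreal\<close>, where
  \<open>infsum\<close> and \<open>SUP\<close> have their true value in $[0,\infty]$.\<close>

definition markov_op :: "('a, 'e) markov_system \<Rightarrow> ('a \<Rightarrow> real) \<Rightarrow> 'a \<Rightarrow> ennreal" where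
  "markov_op M f x = (\<Sum>\<^sub>\<infinity>e\<in>edges M. ennreal (prb M e x * f (wmap M e x)))"

definition markov_op_adj :: "('a, 'e) markov_system \<Rightarrow> 'a measure \<Rightarrow> ('a \<Rightarrow> real) \<Rightarrow> ennreal" where
  "markov_op_adj M \<nu> f = (\<integral>\<^sup>+x. markov_op M f x \<partial>\<nu>)"

definition invariant_probs :: "('a::complete_space, 'e) markov_system \<Rightarrow> 'a measure set" where
  "invariant_probs M =
     {\<mu> \<in> borel_probs.
        \<forall>f\<in>borel_measurable borel. (\<forall>x. 0 \<le> f x) \<and> bounded (range f) \<longrightarrow>
          markov_op_adj M \<mu> f = (\<integral>\<^sup>+x. ennreal (f x) \<partial>\<mu>)}"

definition contractive_with_rate :: "('a::complete_space, 'e) markov_system \<Rightarrow> real \<Rightarrow> bool" where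
  "contractive_with_rate M a \<longleftrightarrow>
     (\<forall>j\<in>verts M. \<forall>x\<in>cell M j. \<forall>y\<in>cell M j.
        (\<Sum>\<^sub>\<infinity>e\<in>edges_from M j. ennreal (prb M e x * dist (wmap M e x) (wmap M e y)))
          \<le> ennreal (a * dist x y))"

definition contractive :: "('a::complete_space, 'e) markov_system \<Rightarrow> bool" where
  "contractive M \<longleftrightarrow> (\<exists>a. 0 < a \<and> a < 1 \<and> contractive_with_rate M a)"

definition uniformly_continuous_system :: "('a::complete_space, 'e) markov_system \<Rightarrow> bool" where
  "uniformly_continuous_system M \<longleftrightarrow>
     (\<forall>e\<in>edges M. uniformly_continuous_on (cell M (ini M e)) (wmap M e) \<and>
                  uniformly_continuous_on (cell M (ini M e)) (prb M e))"

definition dom_mass :: "('a, 'e) markov_system \<Rightarrow> nat \<Rightarrow> ennreal" where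
  "dom_mass M i = (\<Sum>\<^sub>\<infinity>e\<in>edges_from M i. SUP x\<in>cell M i. ennreal (prb M e x))"

definition has_dominating_chain :: "('a, 'e) markov_system \<Rightarrow> bool" where
  "has_dominating_chain M \<longleftrightarrow> (\<forall>i\<in>verts M. dom_mass M i < \<infinity>)"

definition dom_trans :: "('a, 'e) markov_system \<Rightarrow> nat \<Rightarrow> nat \<Rightarrow> ennreal" where
  "dom_trans M i j =
     (\<Sum>\<^sub>\<infinity>e\<in>{e\<in>edges_from M i. ter M e = j}. SUP x\<in>cell M i. ennreal (prb M e x)) / dom_mass M i"

definition dom_const :: "('a, 'e) markov_system \<Rightarrow> ennreal" where
  "dom_const M = (\<Sum>\<^sub>\<infinity>j\<in>verts M. SUP i\<in>verts M. dom_mass M i * dom_trans M i j)"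


text \<open>The point at infinity of the alphabet is \<open>None\<close>.\<close>

primrec ini_ext :: "('a, 'e) markov_system \<Rightarrow> 'e option \<Rightarrow> nat" where
  "ini_ext M None = 1"
| "ini_ext M (Some e) = ini M e"

primrec ter_ext :: "('a, 'e) markov_system \<Rightarrow> 'e option \<Rightarrow> nat" where
  "ter_ext M None = 1"
| "ter_ext M (Some e) = ter M e"

primrec wmap_ext :: "('a, 'e) markov_system \<Rightarrow> 'e option \<Rightarrow> 'a \<Rightarrow> 'a" where
  "wmap_ext M None = id"
| "wmap_ext M (Some e) = wmap M e"

definition alphabet :: "('a, 'e) markov_system \<Rightarrow> 'e option topology" where
  "alphabet M = Alexandroff_compactification (discrete_topology (edges M))"

definition code_space :: "('a, 'e) markov_system \<Rightarrow> (int \<Rightarrow> 'e option) topology" where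
  "code_space M = product_topology (\<lambda>_. alphabet M) UNIV"

definition shift :: "(int \<Rightarrow> 'e option) \<Rightarrow> int \<Rightarrow> 'e option" where
  "shift \<sigma> = (\<lambda>k. \<sigma> (k + 1))"

definition shift_invariant_probs ::
    "('a, 'e) markov_system \<Rightarrow> (int \<Rightarrow> 'e option) measure set" where
  "shift_invariant_probs M =
     {\<Lambda>. prob_space \<Lambda> \<and> sets \<Lambda> = sets (borel_of (code_space M)) \<and>
          distr \<Lambda> (borel_of (code_space M)) shift = \<Lambda>}"

definition cylinder ::
    "('a, 'e) markov_system \<Rightarrow> int \<Rightarrow> int \<Rightarrow> (int \<Rightarrow> 'e option) \<Rightarrow> (int \<Rightarrow> 'e option) set" where
  "cylinder M m n e = {\<sigma> \<in> topspace (code_space M). \<forall>k\<in>{m..n}. \<sigma> k = e k}"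

definition past_algebra :: "('a, 'e) markov_system \<Rightarrow> (int \<Rightarrow> 'e option) measure" where
  "past_algebra M =
     sigma (topspace (code_space M))
       {cylinder M m 0 e | m e. m \<le> 0 \<and> (\<forall>k\<in>{m..0}. e k \<in> topspace (alphabet M))}"

definition path_space :: "('a, 'e) markov_system \<Rightarrow> (int \<Rightarrow> 'e option) set" where
  "path_space M =
     {\<sigma> \<in> topspace (code_space M).
        \<forall>n. \<sigma> n \<in> Some ` edges M \<and> ini_ext M (\<sigma> (n + 1)) = ter_ext M (\<sigma> n)}"

text \<open>\<open>back_comp M \<sigma> n\<close> is $w_{\sigma_0} \circ \dots \circ w_{\sigma_{-n}}$, so the limit along
  $m \to -\infty$ becomes a sequential limit in $n = -m$.\<close>

primrec back_comp :: "('a, 'e) markov_system \<Rightarrow> (int \<Rightarrow> 'e option) \<Rightarrow> nat \<Rightarrow> 'a \<Rightarrow> 'a" where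
  "back_comp M \<sigma> 0 = wmap_ext M (\<sigma> 0)"
| "back_comp M \<sigma> (Suc n) = back_comp M \<sigma> n \<circ> wmap_ext M (\<sigma> (- int (Suc n)))"

definition back_orbit ::
    "('a, 'e) markov_system \<Rightarrow> (nat \<Rightarrow> 'a) \<Rightarrow> (int \<Rightarrow> 'e option) \<Rightarrow> nat \<Rightarrow> 'a" where
  "back_orbit M x \<sigma> n = back_comp M \<sigma> n (x (ini_ext M (\<sigma> (- int n))))"

definition coding_dom ::
    "('a::complete_space, 'e) markov_system \<Rightarrow> (nat \<Rightarrow> 'a) \<Rightarrow> (int \<Rightarrow> 'e option) set" where
  "coding_dom M x = {\<sigma> \<in> path_space M. convergent (back_orbit M x \<sigma>)}"

definition coding_map ::
    "('a::complete_space, 'e) markov_system \<Rightarrow> (nat \<Rightarrow> 'a) \<Rightarrow> (int \<Rightarrow> 'e option) \<Rightarrow> 'a" where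
  "coding_map M x \<sigma> =
     (if \<sigma> \<in> coding_dom M x then lim (back_orbit M x \<sigma>) else x (ter_ext M (\<sigma> 0)))"

definition base_const :: "('a::complete_space, 'e) markov_system \<Rightarrow> (nat \<Rightarrow> 'a) \<Rightarrow> ennreal" where
  "base_const M x =
     (SUP i\<in>verts M. SUP y\<in>cell M i.
        \<Sum>\<^sub>\<infinity>e\<in>edges_from M i.
          ennreal (prb M e y * dist (wmap M e (x (ini M e))) (x (ter M e))))"

definition paths_ending :: "('a, 'e) markov_system \<Rightarrow> nat \<Rightarrow> (int \<Rightarrow> 'e option) set" where
  "paths_ending M j = {\<sigma> \<in> path_space M. ter_ext M (\<sigma> 0) = j}"

text \<open>There is at most one such \<open>g\<close>, and exactly one for a uniformly continuous system.\<close>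

definition prb_closure :: "('a::complete_space, 'e) markov_system \<Rightarrow> 'e \<Rightarrow> 'a \<Rightarrow> real" where
  "prb_closure M e =
     (THE g. continuous_on (closure (cell M (ini M e))) g \<and>
             (\<forall>z\<in>cell M (ini M e). g z = prb M e z) \<and>
             (\<forall>z. z \<notin> closure (cell M (ini M e)) \<longrightarrow> g z = 0))"

definition equilibrium_probs ::
    "('a::complete_space, 'e) markov_system \<Rightarrow> (nat \<Rightarrow> 'a) \<Rightarrow> (int \<Rightarrow> 'e option) measure set" where
  "equilibrium_probs M x =
     {\<Lambda> \<in> shift_invariant_probs M.
        emeasure \<Lambda> (coding_dom M x) = 1 \<and>
        (\<forall>e\<in>edges M. AE \<sigma> in \<Lambda>.
           real_cond_exp \<Lambda> (past_algebra M) (indicator (cylinder M 1 1 (\<lambda>_. Some e))) \<sigma> =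
             prb_closure M e (coding_map M x \<sigma>) * indicator (paths_ending M (ini M e)) \<sigma>)}"

definition consistent :: "('a::complete_space, 'e) markov_system \<Rightarrow> (nat \<Rightarrow> 'a) \<Rightarrow> bool" where
  "consistent M x \<longleftrightarrow>
     (\<forall>\<Lambda>\<in>equilibrium_probs M x. distr \<Lambda> borel (coding_map M x) \<in> invariant_probs M)"

end

theory Submission
  imports Defs
begin

text \<open>
  Consistency says that the image under the coding map of every law in
  \<^const>\<open>equilibrium_probs\<close> is invariant, so it suffices to produce one such law. It is a limit of
  time averages of the chain started at a base point, and the hypotheses enter as follows.

  Record the edges chosen by the chain started at \<open>x 1\<close>, most recent edge first; after \<open>k\<close> steps this
  is a discrete random word of length \<open>k\<close> (\<open>history\<close>). Whatever the current state is, the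
  next vertex equals \<open>j\<close> with probability at most $\sup_i \xi_i q_{ij}$, and these bounds have the
  finite sum $c$; given the vertex, the next edge is dominated by a summable family, because
  $\xi_j < \infty$. Hence the last edge is tight uniformly in time (\<open>last_edge_tight\<close>), and so are
  words of any fixed length. Averaging over a window of times that moves to infinity, and passing to a
  limit along a filter that comes from compactness of a product of unit intervals, gives
  for every length a genuine probability law on words, without loss of mass. Averaging makes these laws
  stationary (\<open>limit_words_exist\<close>), and Kolmogorov's extension theorem turns
  them into a shift invariant law on the code space that lives on admissible paths (\<open>code_law_exists\<close>).

  Contractivity and $b < \infty$ control the coding map. The mean distance from the state of
  the chain to the base point of its cell satisfies $z_{k+1} \le a z_k + b$, hence stays bounded
  by a constant $C$; applying the last $l$ maps both to the state $l$ steps ago and to the base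
  point of its cell brings them within mean distance $C a^l$ (\<open>gap_bound\<close>). Two conclusions
  survive in the limit. The increments of the backward orbit are almost surely summable, so
  the orbit converges and the law is carried by the domain of the coding map
  (\<open>AE_coding_dom\<close>). Moreover, in the chain the conditional probability of the next edge \<open>e\<close> is
  \<open>prb M e\<close> at the present state; uniform continuity of \<open>prb M e\<close> allows the state to be replaced by
  a point reconstructed from the last \<open>l\<close> edges, at a cost that vanishes as \<open>l\<close> grows, uniformly in
  time (\<open>next_edge_limit\<close>). Since that point depends on finitely many edges only, the identity passes
  to the limit law, and letting \<open>l\<close> tend to infinity yields the conditional probability
  prescribed for an equilibrium law (\<open>equilibrium\<close>).
\<close>

section \<open>Countable sums and limits of tight families of discrete laws\<close>

text \<open>A product of copies of $[0,1]$ is compact, so the sequence of functions has a cluster point, and the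
limit exists along the trace of its neighbourhoods on the sequence. A filter takes the place of a
subsequence, which need not exist when the index type is uncountable.\<close>

lemma pointwise_limit_along_filter:
  fixes u :: "nat \<Rightarrow> 'w \<Rightarrow> real"
  assumes "\<And>n w. u n w \<in> {0..1}"
  obtains G L where "G \<noteq> bot" "G \<le> sequentially" "\<And>w. ((\<lambda>n. u n w) \<longlongrightarrow> L w) G"
proof -
  have "compactin (product_topology (\<lambda>_. euclidean) UNIV) (Pi\<^sub>E UNIV (\<lambda>_::'w. {0..1::real}))"
    by (auto simp: compactin_PiE)
  then have "compact (Pi\<^sub>E UNIV (\<lambda>_::'w. {0..1::real}))"
    by (simp add: euclidean_product_topology)
  moreover have "filtermap u sequentially \<noteq> bot"
    by (simp add: filtermap_bot_iff)
  moreover have "\<forall>\<^sub>F f in filtermap u sequentially. f \<in> Pi\<^sub>E UNIV (\<lambda>_::'w. {0..1::real})"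
    using assms by (auto simp: eventually_filtermap PiE_UNIV_domain Pi_def)
  ultimately obtain L where L: "inf (nhds L) (filtermap u sequentially) \<noteq> bot"
    unfolding compact_filter by blast
  define G where "G = inf (filtercomap u (nhds L)) sequentially"
  have "G \<noteq> bot"
  proof
    assume "G = bot"
    then obtain P Q where P: "eventually P (filtercomap u (nhds L))" "eventually Q sequentially" "\<And>n. \<not> (P n \<and> Q n)"
      unfolding G_def trivial_limit_def eventually_inf by auto
    then obtain R where R: "eventually R (nhds L)" "\<And>n. R (u n) \<Longrightarrow> P n"
      unfolding eventually_filtercomap by blast
    have "eventually (\<lambda>f. \<not> R f) (filtermap u sequentially)"
      unfolding eventually_filtermap using P(2) by eventually_elim (use P(3) R(2) in blast)
    with R(1) have "eventually (\<lambda>_. False) (inf (nhds L) (filtermap u sequentially))"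
      unfolding eventually_inf by blast
    with L show False by (simp add: trivial_limit_def)
  qed
  moreover have "((\<lambda>n. u n w) \<longlongrightarrow> L w) G" for w
  proof -
    have "filterlim u (nhds L) G"
      unfolding G_def by (rule filterlim_mono[OF filterlim_filtercomap order_refl inf_le1])
    moreover have "((\<lambda>f. f w) \<longlongrightarrow> L w) (nhds L)"
    proof -
      have "open ((\<lambda>f::'w \<Rightarrow> real. f w) -` S)" if "open S" for S
        using continuous_on_open_vimage[OF open_UNIV] continuous_on_product_coordinates[of w, where ?'b=real] that
        by fastforce
      then show ?thesis
        unfolding tendsto_def eventually_nhds by (metis vimage_eq)
    qed
    ultimately show ?thesis
      by (rule filterlim_compose[rotated])
  qed
  ultimately show ?thesis
    by (intro that[of G L]) (auto simp: G_def)
qed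

lemma nn_integral_count_space_infsum:
  fixes f :: "'b \<Rightarrow> ennreal"
  assumes "countable A"
  shows "(\<integral>\<^sup>+x. f x \<partial>count_space A) = (\<Sum>\<^sub>\<infinity>x\<in>A. f x)"
proof (cases "finite A")
  case True
  then show ?thesis by (simp add: nn_integral_count_space_finite)
next
  case False
  then have bij: "bij_betw (from_nat_into A) UNIV A"
    using assms by (intro bij_betw_from_nat_into)
  have "(\<integral>\<^sup>+x. f x \<partial>count_space A) = (\<integral>\<^sup>+n. f (from_nat_into A n) \<partial>count_space UNIV)"
    by (rule nn_integral_bij_count_space[OF bij, symmetric])
  also have "\<dots> = (\<Sum>n. f (from_nat_into A n))"
    by (rule nn_integral_count_space_nat)
  also have "\<dots> = (\<Sum>\<^sub>\<infinity>n. f (from_nat_into A n))"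
    by (intro sums_unique[symmetric] has_sum_imp_sums has_sum_infsum nonneg_summable_on_complete) auto
  also have "\<dots> = (\<Sum>\<^sub>\<infinity>x\<in>A. f x)"
    by (rule infsum_reindex_bij_betw[OF bij])
  finally show ?thesis .
qed

lemma nn_integral_count_space_has_sum:
  fixes f :: "'b \<Rightarrow> real"
  assumes "(f has_sum s) A" "\<And>x. x \<in> A \<Longrightarrow> 0 \<le> f x"
  shows "(\<integral>\<^sup>+x. ennreal (f x) \<partial>count_space A) = ennreal s"
proof -
  have "f summable_on A" using assms(1) by (auto simp: summable_on_def)
  then have "(\<lambda>x. norm (f x)) summable_on A"
    by (rule summable_on_iff_abs_summable_on_real[THEN iffD1])
  then have *: "Infinite_Set_Sum.abs_summable_on f A"
    by (rule abs_summable_equivalent[THEN iffD1])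
  show ?thesis
    using nn_integral_conv_infsetsum[OF *] infsetsum_infsum[OF *] assms by (simp add: infsumI)
qed

text \<open>A pointwise limit of probability mass functions can lose mass only at infinity, which tightness
forbids: a finite set that eventually carries all but \<open>\<epsilon>\<close> of the mass still does so in the limit.
Bounded expectations converge because they are finite sums up to a uniformly small error.\<close>

lemma tight_pmf_limit:
  fixes p :: "'i \<Rightarrow> 'b pmf"
  assumes G: "G \<noteq> bot"
    and lim: "\<And>b. ((\<lambda>i. pmf (p i) b) \<longlongrightarrow> f b) G"
    and tight: "\<And>\<epsilon>. \<epsilon> > 0 \<Longrightarrow> \<exists>A. finite A \<and> (\<forall>\<^sub>F i in G. measure_pmf.prob (p i) (-A) \<le> \<epsilon>)"
  obtains q where "\<And>b. pmf q b = f b"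
    and "\<And>(h :: 'b \<Rightarrow> real) B. (\<And>b. \<bar>h b\<bar> \<le> B) \<Longrightarrow>
      ((\<lambda>i. measure_pmf.expectation (p i) h) \<longlongrightarrow> measure_pmf.expectation q h) G"
proof -
  have nonneg: "0 \<le> f b" for b
    by (rule tendsto_lowerbound[OF lim _ G]) simp
  have sumlim: "((\<lambda>i. measure_pmf.prob (p i) A) \<longlongrightarrow> sum f A) G" if "finite A" for A
    using that by (simp add: measure_measure_pmf_finite) (intro tendsto_sum lim)
  have le1: "sum f A \<le> 1" if "finite A" for A
    by (rule tendsto_upperbound[OF sumlim[OF that] _ G]) simp
  have ge: "\<exists>A. finite A \<and> 1 - \<epsilon> \<le> sum f A \<and> (\<forall>\<^sub>F i in G. measure_pmf.prob (p i) (-A) \<le> \<epsilon>)"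
    if pos: "\<epsilon> > 0" for \<epsilon>
  proof -
    obtain A where A: "finite A" "\<forall>\<^sub>F i in G. measure_pmf.prob (p i) (-A) \<le> \<epsilon>"
      using tight[OF pos] by blast
    have "\<forall>\<^sub>F i in G. 1 - \<epsilon> \<le> measure_pmf.prob (p i) A"
      using A(2) by eventually_elim (simp add: measure_pmf.prob_compl[of A, simplified] Compl_eq_Diff_UNIV)
    from tendsto_lowerbound[OF sumlim[OF A(1)] this G] A show ?thesis by blast
  qed
  have "(f has_sum 1) UNIV"
    unfolding has_sum_def tendsto_iff eventually_finite_subsets_at_top
  proof (intro allI impI)
    fix e :: real assume "e > 0"
    then obtain A where A: "finite A" "1 - e/2 \<le> sum f A" using ge[of "e/2"] by auto
    have "dist (sum f Y) 1 < e" if Y: "finite Y" "A \<subseteq> Y" for Y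
    proof -
      have "sum f A \<le> sum f Y" using Y nonneg by (intro sum_mono2) auto
      with A le1[OF Y(1)] \<open>e > 0\<close> show ?thesis by (auto simp: dist_real_def)
    qed
    with A(1) show "\<exists>X. finite X \<and> X \<subseteq> UNIV \<and> (\<forall>Y. finite Y \<and> X \<subseteq> Y \<and> Y \<subseteq> UNIV \<longrightarrow> dist (sum f Y) 1 < e)"
      by blast
  qed
  from nn_integral_count_space_has_sum[OF this] nonneg
  have one: "(\<integral>\<^sup>+b. ennreal (f b) \<partial>count_space UNIV) = 1" by simp
  define q where "q = embed_pmf f"
  have q: "pmf q b = f b" for b
    unfolding q_def by (rule pmf_embed_pmf[OF nonneg one])
  have "((\<lambda>i. measure_pmf.expectation (p i) h) \<longlongrightarrow> measure_pmf.expectation q h) G"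
    if bd: "\<And>b. \<bar>h b\<bar> \<le> B" for h :: "'b \<Rightarrow> real" and B
  proof (rule tendstoI)
    fix e :: real assume "e > 0"
    have B: "0 \<le> B" by (rule order_trans[OF abs_ge_zero bd])
    \<comment> \<open>The tails of both laws contribute \<open>2 * B * \<epsilon>\<close>; the rest of \<open>e\<close> is left for the finite sums.\<close>
    define \<epsilon> where "\<epsilon> = e / (4 * (B + 1))"
    have \<epsilon>: "\<epsilon> > 0" "2 * (B * \<epsilon>) < e/2 + e/4"
      using \<open>e > 0\<close> B by (auto simp: \<epsilon>_def field_simps intro!: add_pos_nonneg)
    obtain A where A: "finite A" "1 - \<epsilon> \<le> sum f A" "\<forall>\<^sub>F i in G. measure_pmf.prob (p i) (-A) \<le> \<epsilon>"
      using ge[OF \<epsilon>(1)] by blast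
    have approx: "\<bar>measure_pmf.expectation r h - (\<Sum>b\<in>A. pmf r b * h b)\<bar> \<le> B * \<epsilon>"
      if "measure_pmf.prob r (-A) \<le> \<epsilon>" for r :: "'b pmf"
    proof -
      have int: "integrable (measure_pmf r) h"
        by (rule measure_pmf.integrable_const_bound[where B=B]) (use bd in auto)
      have intA: "integrable (measure_pmf r) (\<lambda>b. h b * indicator C b)" for C
        by (rule measure_pmf.integrable_const_bound[where B=B]) (use bd B in \<open>auto split: split_indicator\<close>)
      have "measure_pmf.expectation r h = measure_pmf.expectation r (\<lambda>b. h b * indicator A b + h b * indicator (-A) b)"
        by (intro Bochner_Integration.integral_cong) (auto split: split_indicator)
      also have "\<dots> = measure_pmf.expectation r (\<lambda>b. h b * indicator A b) + measure_pmf.expectation r (\<lambda>b. h b * indicator (-A) b)"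
        by (intro Bochner_Integration.integral_add intA)
      also have "measure_pmf.expectation r (\<lambda>b. h b * indicator A b) = (\<Sum>b\<in>A. pmf r b * h b)"
        by (subst integral_measure_pmf_real[OF A(1)]) (auto simp: mult.commute split: split_indicator_asm)
      finally have eq: "measure_pmf.expectation r h - (\<Sum>b\<in>A. pmf r b * h b) = measure_pmf.expectation r (\<lambda>b. h b * indicator (-A) b)"
        by simp
      have "\<bar>measure_pmf.expectation r (\<lambda>b. h b * indicator (-A) b)\<bar> \<le> measure_pmf.expectation r (\<lambda>b. B * indicator (-A) b)"
      proof (rule order_trans[OF integral_abs_bound], rule integral_mono)
        show "integrable (measure_pmf r) (\<lambda>b. \<bar>h b * indicator (-A) b\<bar>)"
          by (rule integrable_abs[OF intA])
        show "integrable (measure_pmf r) (\<lambda>b. B * indicator (-A) b)"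
          by (rule measure_pmf.integrable_const_bound[where B=B]) (use B in \<open>auto split: split_indicator\<close>)
      qed (use bd in \<open>auto simp: abs_mult split: split_indicator\<close>)
      also have "\<dots> = B * measure_pmf.prob r (-A)" by simp
      also have "\<dots> \<le> B * \<epsilon>" using that B by (intro mult_left_mono)
      finally show ?thesis using eq by simp
    qed
    have qA: "measure_pmf.prob q (-A) \<le> \<epsilon>"
      using A(2) measure_pmf.prob_compl[of A q] by (simp add: measure_measure_pmf_finite[OF A(1)] q Compl_eq_Diff_UNIV)
    have "((\<lambda>i. \<Sum>b\<in>A. pmf (p i) b * h b) \<longlongrightarrow> (\<Sum>b\<in>A. pmf q b * h b)) G"
      unfolding q by (intro tendsto_intros lim)
    then have "\<forall>\<^sub>F i in G. dist (\<Sum>b\<in>A. pmf (p i) b * h b) (\<Sum>b\<in>A. pmf q b * h b) < e/4"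
      using \<open>e > 0\<close> by (intro tendstoD) auto
    with A(3) show "\<forall>\<^sub>F i in G. dist (measure_pmf.expectation (p i) h) (measure_pmf.expectation q h) < e"
    proof eventually_elim
      case (elim i)
      from approx[OF elim(1)] approx[OF qA] elim(2) \<epsilon>(2) show ?case
        unfolding dist_real_def abs_less_iff abs_le_iff by linarith
    qed
  qed
  with q show ?thesis by (rule that)
qed

text \<open>Applied to the bounds on vertices and on edges, this supplies the finite sets needed for tightness.\<close>

lemma infsum_small_tail:
  fixes f :: "'b \<Rightarrow> ennreal"
  assumes fin: "(\<Sum>\<^sub>\<infinity>x\<in>A. f x) < \<infinity>" and "\<epsilon> > 0"
  obtains F where "finite F" "F \<subseteq> A" "(\<Sum>\<^sub>\<infinity>x\<in>A - F. f x) \<le> \<epsilon>"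
proof -
  have S: "(\<Sum>\<^sub>\<infinity>x\<in>A. f x) = (SUP F\<in>{F. finite F \<and> F \<subseteq> A}. sum f F)"
    by (rule nonneg_infsum_complete) simp
  have "\<exists>F\<in>{F. finite F \<and> F \<subseteq> A}. (\<Sum>\<^sub>\<infinity>x\<in>A. f x) \<le> sum f F + \<epsilon>"
  proof (cases "(\<Sum>\<^sub>\<infinity>x\<in>A. f x) = 0")
    case True
    then show ?thesis by (intro bexI[of _ "{}"]) auto
  next
    case False
    then have "(\<Sum>\<^sub>\<infinity>x\<in>A. f x) - \<epsilon> < (\<Sum>\<^sub>\<infinity>x\<in>A. f x)"
      using fin \<open>\<epsilon> > 0\<close> by (intro ennreal_between) (auto simp: zero_less_iff_neq_zero)
    then obtain F where F: "finite F" "F \<subseteq> A" "(\<Sum>\<^sub>\<infinity>x\<in>A. f x) - \<epsilon> < sum f F"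
      unfolding S less_SUP_iff by auto
    from less_imp_le[OF F(3)] have "(\<Sum>\<^sub>\<infinity>x\<in>A. f x) \<le> sum f F + \<epsilon>"
      by (simp add: ennreal_minus_le_iff add.commute)
    with F show ?thesis by auto
  qed
  then obtain F where F: "finite F" "F \<subseteq> A" "(\<Sum>\<^sub>\<infinity>x\<in>A. f x) \<le> sum f F + \<epsilon>" by auto
  have "(\<Sum>\<^sub>\<infinity>x\<in>A. f x) = (\<Sum>\<^sub>\<infinity>x\<in>F \<union> (A - F). f x)"
    using F(2) by (simp add: Un_absorb1)
  also have "\<dots> = (\<Sum>\<^sub>\<infinity>x\<in>F. f x) + (\<Sum>\<^sub>\<infinity>x\<in>A - F. f x)"
    by (intro infsum_Un_disjoint nonneg_summable_on_complete) auto
  finally have "sum f F + (\<Sum>\<^sub>\<infinity>x\<in>A - F. f x) \<le> sum f F + \<epsilon>"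
    using F by simp
  moreover have "sum f F < \<infinity>"
    using fin F(1,2) unfolding S by (intro le_less_trans[OF SUP_upper fin[unfolded S]]) auto
  ultimately have "(\<Sum>\<^sub>\<infinity>x\<in>A - F. f x) \<le> \<epsilon>"
    by (auto simp: ennreal_add_left_cancel_le)
  with F show ?thesis by (intro that)
qed

section \<open>Two-sided stationary sequences from consistent word laws\<close>

text \<open>Words list the most recent letter first: position \<open>j\<close> of the window holds the letter at time \<open>n - j\<close>.\<close>

definition window :: "int \<Rightarrow> nat \<Rightarrow> (int \<Rightarrow> 'c) \<Rightarrow> 'c list" where
  "window n l f = map (\<lambda>j. f (n - int j)) [0..<l]"

lemma map_upt_eq_iff: "map g [0..<l] = v \<longleftrightarrow> length v = l \<and> (\<forall>j\<in>{..<l}. g j = v ! j)"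
  by (auto simp: list_eq_iff_nth_eq)

lemma length_window [simp]: "length (window n l f) = l"
  by (simp add: window_def)

lemma nth_window [simp]: "j < l \<Longrightarrow> window n l f ! j = f (n - int j)"
  by (simp add: window_def)

text \<open>For words that end at a common time, \<open>take\<close> forgets the oldest letter and \<open>tl\<close> the newest one. The
first condition is consistency of the finite-dimensional laws, and together with the second it says
that the law of a subword does not depend on where the subword sits.\<close>

locale stationary_words =
  fixes q :: "nat \<Rightarrow> 'c list pmf"
  assumes length_q: "\<And>l v. v \<in> set_pmf (q l) \<Longrightarrow> length v = l"
    and take_q: "\<And>l. map_pmf (take l) (q (Suc l)) = q l"
    and tl_q: "\<And>l. map_pmf tl (q (Suc l)) = q l"
begin

lemma subword_q: "map_pmf (\<lambda>v. take l (drop m v)) (q (m + l + r)) = q l"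
proof -
  have 1: "map_pmf (take l) (q (l + r)) = q l" for l r
  proof (induction r)
    case 0
    have "map_pmf (take l) (q l) = map_pmf id (q l)"
      by (intro map_pmf_cong) (auto dest: length_q)
    then show ?case by simp
  next
    case (Suc r)
    have "map_pmf (take l) (q (l + Suc r)) = map_pmf (take l) (map_pmf (take (l + r)) (q (Suc (l + r))))"
      by (simp add: pmf.map_comp o_def min_def)
    then show ?case by (simp add: take_q Suc)
  qed
  have 2: "map_pmf (drop m) (q (m + l)) = q l" for m l
  proof (induction m)
    case (Suc m)
    have "map_pmf (drop (Suc m)) (q (Suc m + l)) = map_pmf (drop m) (map_pmf tl (q (Suc (m + l))))"
      by (simp add: pmf.map_comp o_def drop_Suc[abs_def])
    then show ?case by (simp add: tl_q Suc)
  qed (simp add: pmf.map_ident)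
  have "map_pmf (\<lambda>v. take l (drop m v)) (q (m + l + r)) = map_pmf (take l) (map_pmf (drop m) (q (m + (l + r))))"
    by (simp add: pmf.map_comp o_def add.assoc)
  then show ?thesis by (simp add: 1 2)
qed

end

lemma measurable_window [measurable]:
  "window n l \<in> measurable (PiM UNIV (\<lambda>_. count_space (UNIV :: 'c::countable set))) (count_space UNIV)"
proof (subst measurable_count_space_eq_countable, safe)
  fix v :: "'c list"
  have "window n l -` {v} = (if length v = l then {f. \<forall>j<l. f (n - int j) = v ! j} else {})"
    by (auto simp: list_eq_iff_nth_eq)
  moreover have "Measurable.pred (PiM UNIV (\<lambda>_. count_space (UNIV :: 'c set))) (\<lambda>f. \<forall>j<l. f (n - int j) = v ! j)"
    by measurable
  ultimately show "window n l -` {v} \<inter> space (PiM UNIV (\<lambda>_. count_space UNIV)) \<in> sets (PiM UNIV (\<lambda>_. count_space (UNIV :: 'c set)))"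
    by (auto simp: pred_def space_PiM)
qed auto

text \<open>Cylinders over finite index sets determine the law, and a finite set of integers lies in an interval.\<close>

lemma window_laws_determine:
  fixes P Q :: "(int \<Rightarrow> 'c::countable) measure"
  assumes P: "prob_space P" "sets P = sets (PiM UNIV (\<lambda>_. count_space UNIV))"
    and Q: "sets Q = sets (PiM UNIV (\<lambda>_. count_space UNIV))"
    and eq: "\<And>n l. distr P (count_space UNIV) (window n l) = distr Q (count_space UNIV) (window n l)"
  shows "P = Q"
proof (rule measure_eqI_PiM_infinite[OF P(2) Q])
  interpret P: prob_space P by fact
  show "finite_measure P" by unfold_locales
  fix J :: "int set" and A :: "int \<Rightarrow> 'c set"
  assume J: "finite J"
  obtain a b where ab: "J \<subseteq> {a..b}"
  proof (cases "J = {}")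
    case False
    then have "J \<subseteq> {Min J..Max J}" using J by auto
    then show ?thesis by (rule that)
  qed auto
  define l where "l = nat (b - a + 1)"
  define V where "V = {v :: 'c list. \<forall>j<l. b - int j \<in> J \<longrightarrow> v ! j \<in> A (b - int j)}"
  have pre: "prod_emb UNIV (\<lambda>_. count_space UNIV) J (Pi\<^sub>E J A) = window b l -` V"
  proof (intro set_eqI)
    fix f
    have "f \<in> prod_emb UNIV (\<lambda>_. count_space UNIV) J (Pi\<^sub>E J A) \<longleftrightarrow> (\<forall>i\<in>J. f i \<in> A i)"
      by (auto simp: prod_emb_def PiE_def Pi_def extensional_def)
    also have "\<dots> \<longleftrightarrow> (\<forall>j<l. b - int j \<in> J \<longrightarrow> f (b - int j) \<in> A (b - int j))"
    proof (intro iffI ballI)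
      fix i assume i: "i \<in> J" and *: "\<forall>j<l. b - int j \<in> J \<longrightarrow> f (b - int j) \<in> A (b - int j)"
      have "nat (b - i) < l" "b - int (nat (b - i)) = i" using i ab by (auto simp: l_def)
      with * i show "f i \<in> A i" by metis
    qed auto
    finally show "f \<in> prod_emb UNIV (\<lambda>_. count_space UNIV) J (Pi\<^sub>E J A) \<longleftrightarrow> f \<in> window b l -` V"
      by (auto simp: V_def)
  qed
  have spc: "space P = UNIV" "space Q = UNIV"
    using sets_eq_imp_space_eq[OF P(2)] sets_eq_imp_space_eq[OF Q] by (auto simp: space_PiM)
  have m: "window b l \<in> measurable P (count_space UNIV)" "window b l \<in> measurable Q (count_space UNIV)"
    by (simp_all add: measurable_cong_sets[OF P(2) refl] measurable_cong_sets[OF Q refl])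
  show "emeasure P (prod_emb UNIV (\<lambda>_. count_space UNIV) J (Pi\<^sub>E J A)) =
        emeasure Q (prod_emb UNIV (\<lambda>_. count_space UNIV) J (Pi\<^sub>E J A))"
    using arg_cong[OF eq[of b l], of "\<lambda>R. emeasure R V"]
    by (simp add: pre emeasure_distr m spc)
qed

text \<open>Kolmogorov's theorem needs a Polish space, so the letters are mapped to reals by \<open>g\<close>. The
marginal on a finite set \<open>J\<close> of times is read off from the word law of any interval
that covers \<open>J\<close>, and the choice of the interval is immaterial by consistency and stationarity.\<close>

lemma (in stationary_words) two_sided_extension_aux:
  fixes g :: "'c \<Rightarrow> real"
  obtains P :: "(int \<Rightarrow> real) measure"
    where "prob_space P" "sets P = sets (PiM UNIV (\<lambda>_. borel))"
      "\<And>n l. distr P (PiM {n - int l<..n} (\<lambda>_. borel)) (\<lambda>f. restrict f {n - int l<..n}) =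
        distr (measure_pmf (q l)) (PiM {n - int l<..n} (\<lambda>_. borel)) (\<lambda>v. \<lambda>i\<in>{n - int l<..n}. g (v ! nat (n - i)))"
proof -
  define c where "c n J = (\<lambda>v. \<lambda>i\<in>J. g (v ! nat (n - i)))" for n :: int and J
  have c_meas: "c n J \<in> measurable (count_space UNIV) (PiM J (\<lambda>_. borel))" for n J
    by (simp add: c_def space_PiM)
  have c_space [simp]: "c n J v \<in> space (PiM J (\<lambda>_. borel))" for n J v
    by (simp add: c_def space_PiM)
  define R where "R n l J = distr (measure_pmf (q l)) (PiM J (\<lambda>_. borel)) (c n J)" for n l J
  \<comment> \<open>The window of length \<open>l\<close> ending at \<open>n\<close> is the subword of the window of length \<open>L\<close> ending at \<open>N\<close>
     that starts after its \<open>N - n\<close> newest letters.\<close>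
  have R_enlarge: "R n l J = R N L J" if "J \<subseteq> {n - int l<..n}" "n \<le> N" "N - int L \<le> n - int l" for n l J N L
  proof -
    define m r where "m = nat (N - n)" and "r = nat (int L - (N - n) - int l)"
    have L: "L = m + l + r" using that by (auto simp: m_def r_def)
    have "R n l J = distr (measure_pmf (map_pmf (\<lambda>v. take l (drop m v)) (q L))) (PiM J (\<lambda>_. borel)) (c n J)"
      by (simp add: R_def L subword_q)
    also have "\<dots> = distr (measure_pmf (q L)) (PiM J (\<lambda>_. borel)) (\<lambda>v. c n J (take l (drop m v)))"
      unfolding map_pmf_rep_eq by (subst distr_distr) (auto simp: o_def c_meas)
    also have "\<dots> = R N L J"
      unfolding R_def
    proof (rule distr_cong_AE)
      show "AE v in measure_pmf (q L). c n J (take l (drop m v)) = c N J v"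
      proof (subst AE_measure_pmf_iff, intro ballI)
        fix v assume "v \<in> set_pmf (q L)"
        then have len: "length v = L" by (rule length_q)
        have "take l (drop m v) ! nat (n - i) = v ! nat (N - i)" if "i \<in> J" for i
        proof -
          have i: "n - int l < i" "i \<le> n" using that \<open>J \<subseteq> _\<close> by auto
          have "m + nat (n - i) = nat (N - i)" using i \<open>n \<le> N\<close> by (auto simp: m_def)
          with i len L show ?thesis by (simp add: nth_take)
        qed
        then show "c n J (take l (drop m v)) = c N J v" by (auto simp: c_def)
      qed
    qed (simp_all add: c_meas)
    finally show ?thesis .
  qed
  \<comment> \<open>The interval from \<open>- k\<close> to \<open>k\<close> has \<open>2 * k + 1\<close> elements; \<open>0\<close> is inserted to cover the empty set.\<close>
  define k where "k J = nat (Max (abs ` insert (0::int) J))" for J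
  have k: "J \<subseteq> {int (k J) - int (2 * k J + 1)<..int (k J)}" if "finite J" for J
  proof
    fix i assume "i \<in> J"
    then have "\<bar>i\<bar> \<le> Max (abs ` insert 0 J)" using that by (intro Max_ge) auto
    then show "i \<in> {int (k J) - int (2 * k J + 1)<..int (k J)}" by (auto simp: k_def)
  qed
  define P where "P J = R (int (k J)) (2 * k J + 1) J" for J
  have P_eq: "P J = R n l J" if "finite J" "J \<subseteq> {n - int l<..n}" for J n l
  proof -
    define N where "N = max (int (k J)) n"
    define L where "L = nat (N - min (int (k J) - int (2 * k J + 1)) (n - int l))"
    have "P J = R N L J" unfolding P_def
      by (rule R_enlarge[OF k[OF that(1)]]) (auto simp: N_def L_def)
    also have "\<dots> = R n l J" by (rule R_enlarge[OF that(2), symmetric]) (auto simp: N_def L_def)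
    finally show ?thesis .
  qed
  interpret polish_projective UNIV P
  proof (intro polish_projective.intro projective_family.intro)
    fix J H :: "int set" assume JH: "J \<subseteq> H" "finite H"
    have fJ: "finite J" using JH finite_subset by blast
    have "P J = R (int (k H)) (2 * k H + 1) J"
      using JH k[OF JH(2)] by (intro P_eq fJ) auto
    also have "\<dots> = distr (P H) (PiM J (\<lambda>_. borel)) (\<lambda>f. restrict f J)"
      unfolding P_def R_def
      by (subst distr_distr) (use JH in \<open>auto simp: c_meas o_def c_def space_PiM Int_absorb1 intro!: distr_cong measurable_restrict_subset\<close>)
    finally show "P J = distr (P H) (PiM J (\<lambda>_. borel)) (\<lambda>f. restrict f J)" .
  next
    fix J :: "int set" assume "finite J"
    show "prob_space (P J)" unfolding P_def R_def
      by (intro measure_pmf.prob_space_distr) (simp add: c_meas)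
  qed
  show ?thesis
  proof (rule that[of lim])
    show "prob_space lim" by unfold_locales
    show "sets lim = sets (PiM UNIV (\<lambda>_. borel))" by simp
    fix n l
    let ?J = "{n - int l<..n}"
    have "distr lim (PiM ?J (\<lambda>_. borel)) (\<lambda>f. restrict f ?J) = P ?J"
    proof (rule measure_eqI)
      show "sets (distr lim (PiM ?J (\<lambda>_. borel)) (\<lambda>f. restrict f ?J)) = sets (P ?J)"
        by (simp add: sets_P)
      fix A assume "A \<in> sets (distr lim (PiM ?J (\<lambda>_. borel)) (\<lambda>f. restrict f ?J))"
      then have A: "A \<in> sets (PiM ?J (\<lambda>_. borel :: real measure))" by simp
      have "(\<lambda>f. restrict f ?J) \<in> measurable lim (PiM ?J (\<lambda>_. borel))"
        by (subst measurable_cong_sets[OF sets_lim refl]) (rule measurable_restrict_subset, simp)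
      then have "emeasure (distr lim (PiM ?J (\<lambda>_. borel)) (\<lambda>f. restrict f ?J)) A = emeasure lim ((\<lambda>f. restrict f ?J) -` A \<inter> space lim)"
        using A by (rule emeasure_distr)
      also have "(\<lambda>f. restrict f ?J) -` A \<inter> space lim = prod_emb UNIV (\<lambda>_. borel) ?J A"
        by (auto simp: prod_emb_def space_PiM)
      also have "emeasure lim \<dots> = emeasure (P ?J) A"
        by (rule emeasure_lim_emb) (use A in auto)
      finally show "emeasure (distr lim (PiM ?J (\<lambda>_. borel)) (\<lambda>f. restrict f ?J)) A = emeasure (P ?J) A" .
    qed
    also have "\<dots> = R n l ?J" by (rule P_eq) auto
    finally show "distr lim (PiM ?J (\<lambda>_. borel)) (\<lambda>f. restrict f ?J) =
        distr (measure_pmf (q l)) (PiM ?J (\<lambda>_. borel)) (\<lambda>v. \<lambda>i\<in>?J. g (v ! nat (n - i)))"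
      by (simp add: R_def c_def)
  qed
qed

lemma (in stationary_words) two_sided_extension:
  fixes enc :: "'c \<Rightarrow> nat"
  obtains P :: "(int \<Rightarrow> nat) measure"
    where "prob_space P" "sets P = sets (PiM UNIV (\<lambda>_. count_space UNIV))"
      "\<And>n l. distr P (count_space UNIV) (window n l) = measure_pmf (map_pmf (map enc) (q l))"
proof -
  obtain P0 :: "(int \<Rightarrow> real) measure"
    where P0: "prob_space P0" "sets P0 = sets (PiM UNIV (\<lambda>_. borel))"
      and win: "\<And>n l. distr P0 (PiM {n - int l<..n} (\<lambda>_. borel)) (\<lambda>f. restrict f {n - int l<..n}) =
        distr (measure_pmf (q l)) (PiM {n - int l<..n} (\<lambda>_. borel)) (\<lambda>v. \<lambda>i\<in>{n - int l<..n}. real (enc (v ! nat (n - i))))"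
    by (rule two_sided_extension_aux[of "\<lambda>y. real (enc y)"]) blast
  interpret P0: prob_space P0 by fact
  define d where "d = (\<lambda>(f :: int \<Rightarrow> real) i. nat \<lfloor>f i\<rfloor>)"
  have d [measurable]: "d \<in> measurable P0 (PiM UNIV (\<lambda>_. count_space UNIV))"
    unfolding d_def measurable_cong_sets[OF P0(2) refl]
    by (rule measurable_PiM_single') auto
  show ?thesis
  proof (rule that[of "distr P0 (PiM UNIV (\<lambda>_. count_space UNIV)) d"])
    show "prob_space (distr P0 (PiM UNIV (\<lambda>_. count_space UNIV)) d)" by (rule P0.prob_space_distr[OF d])
    fix n l
    let ?J = "{n - int l<..n}"
    define D where "D = (\<lambda>(f :: int \<Rightarrow> real). map (\<lambda>j. nat \<lfloor>f (n - int j)\<rfloor>) [0..<l])"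
    have D [measurable]: "D \<in> measurable (PiM ?J (\<lambda>_. borel)) (count_space UNIV)"
    proof (subst measurable_count_space_eq_countable, safe)
      fix v :: "nat list"
      have "Measurable.pred (PiM ?J (\<lambda>_. borel :: real measure)) (\<lambda>f. \<forall>j\<in>{..<l}. nat \<lfloor>f (n - int j)\<rfloor> = v ! j)"
      proof (rule pred_intros_finite)
        fix j assume "j \<in> {..<l}"
        then have comp: "(\<lambda>f. f (n - int j)) \<in> measurable (PiM ?J (\<lambda>_. borel :: real measure)) borel"
          by (intro measurable_component_singleton) auto
        have "(\<lambda>r::real. nat \<lfloor>r\<rfloor>) \<in> measurable borel (count_space UNIV)" by measurable
        from measurable_compose[OF comp this]
        show "Measurable.pred (PiM ?J (\<lambda>_. borel :: real measure)) (\<lambda>f. nat \<lfloor>f (n - int j)\<rfloor> = v ! j)"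
          by (rule pred_eq_const1) simp
      qed simp
      then have "{f \<in> space (PiM ?J (\<lambda>_. borel)). \<forall>j\<in>{..<l}. nat \<lfloor>f (n - int j)\<rfloor> = v ! j} \<in> sets (PiM ?J (\<lambda>_. borel :: real measure))"
        by (simp only: pred_def)
      moreover have "D -` {v} \<inter> space (PiM ?J (\<lambda>_. borel)) =
          (if length v = l then {f \<in> space (PiM ?J (\<lambda>_. borel)). \<forall>j\<in>{..<l}. nat \<lfloor>f (n - int j)\<rfloor> = v ! j} else {})"
        by (auto simp: D_def map_upt_eq_iff vimage_singleton_eq split: if_split)
      ultimately show "D -` {v} \<inter> space (PiM ?J (\<lambda>_. borel)) \<in> sets (PiM ?J (\<lambda>_. borel))"
        by (cases "length v = l") simp_all
    qed auto
    have r: "(\<lambda>f. restrict f ?J) \<in> measurable P0 (PiM ?J (\<lambda>_. borel))"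
      by (subst measurable_cong_sets[OF P0(2) refl]) (rule measurable_restrict_subset, simp)
    have "distr (distr P0 (PiM UNIV (\<lambda>_. count_space UNIV)) d) (count_space UNIV) (window n l)
        = distr P0 (count_space UNIV) (\<lambda>f. D (restrict f ?J))"
      by (subst distr_distr[OF measurable_window d]) (auto simp: o_def D_def d_def window_def intro!: distr_cong)
    also have "\<dots> = distr (distr P0 (PiM ?J (\<lambda>_. borel)) (\<lambda>f. restrict f ?J)) (count_space UNIV) D"
      by (subst distr_distr) (auto simp: o_def r)
    also have "\<dots> = distr (measure_pmf (q l)) (count_space UNIV) (\<lambda>v. map (\<lambda>j. enc (v ! j)) [0..<l])"
      unfolding win
      by (subst distr_distr[OF D]) (auto simp: space_PiM o_def, auto simp: D_def intro!: distr_cong)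
    also have "\<dots> = distr (measure_pmf (q l)) (count_space UNIV) (map enc)"
      by (rule distr_cong_AE)
         (auto simp: AE_measure_pmf_iff list_eq_iff_nth_eq dest: length_q)
    finally show "distr (distr P0 (PiM UNIV (\<lambda>_. count_space UNIV)) d) (count_space UNIV) (window n l)
        = measure_pmf (map_pmf (map enc) (q l))"
      by (simp add: map_pmf_rep_eq)
  qed simp
qed

section \<open>Histories of the chain\<close>

locale coded_system =
  fixes M :: "('a::complete_space, 'e) markov_system" and x :: "nat \<Rightarrow> 'a"
  assumes system: "countable_markov_system M"
    and base_point: "\<And>i. i \<in> verts M \<Longrightarrow> x i \<in> cell M i"
begin

lemma one_vert: "1 \<in> verts M" and countable_edges: "countable (edges M)"
  and ini_edges: "ini M ` edges M = verts M"
  and cells_cover: "(\<Union>j\<in>verts M. cell M j) = UNIV"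
  and cells_disjoint: "disjoint_family_on (cell M) (verts M)"
  using system by (auto simp: countable_markov_system_def)

lemma ter_vert: "e \<in> edges M \<Longrightarrow> ter M e \<in> verts M"
  and ini_vert: "e \<in> edges M \<Longrightarrow> ini M e \<in> verts M"
  and wmap_cell: "e \<in> edges M \<Longrightarrow> y \<in> cell M (ini M e) \<Longrightarrow> wmap M e y \<in> cell M (ter M e)"
  and wt_nonneg: "e \<in> edges M \<Longrightarrow> y \<in> cell M (ini M e) \<Longrightarrow> 0 \<le> wt M e y"
  and wt_le_1: "e \<in> edges M \<Longrightarrow> y \<in> cell M (ini M e) \<Longrightarrow> wt M e y \<le> 1"
proof -
  have ax: "ter M \<in> edges M \<rightarrow> verts M"
      "\<forall>e\<in>edges M. wmap M e \<in> cell M (ini M e) \<rightarrow> cell M (ter M e) \<and> wt M e \<in> cell M (ini M e) \<rightarrow> {0..1}"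
    using system unfolding countable_markov_system_def by blast+
  show "e \<in> edges M \<Longrightarrow> ter M e \<in> verts M" using ax(1) by blast
  show "e \<in> edges M \<Longrightarrow> ini M e \<in> verts M" using ini_edges by blast
  show "e \<in> edges M \<Longrightarrow> y \<in> cell M (ini M e) \<Longrightarrow> wmap M e y \<in> cell M (ter M e)"
    using ax(2) by blast
  assume "e \<in> edges M" "y \<in> cell M (ini M e)"
  then have "wt M e y \<in> {0..1}" using ax(2) by blast
  then show "0 \<le> wt M e y" "wt M e y \<le> 1" by auto
qed

lemma edges_ne: "edges M \<noteq> {}"
  using ini_edges one_vert by auto

lemma cell_unique: "i \<in> verts M \<Longrightarrow> j \<in> verts M \<Longrightarrow> y \<in> cell M i \<Longrightarrow> y \<in> cell M j \<Longrightarrow> i = j"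
  using cells_disjoint by (auto simp: disjoint_family_on_def)

lemma prb_nonneg: "e \<in> edges M \<Longrightarrow> 0 \<le> prb M e y"
  and prb_le_1: "e \<in> edges M \<Longrightarrow> prb M e y \<le> 1"
  by (auto simp: prb_def wt_nonneg wt_le_1)

lemma prb_off: "y \<in> cell M i \<Longrightarrow> i \<in> verts M \<Longrightarrow> e \<in> edges M \<Longrightarrow> ini M e \<noteq> i \<Longrightarrow> prb M e y = 0"
  by (auto simp: prb_def dest: cell_unique[OF _ ini_vert])

lemma nn_integral_edges_from:
  assumes "y \<in> cell M i" "i \<in> verts M"
  shows "(\<integral>\<^sup>+e. ennreal (prb M e y) * f e \<partial>count_space (edges M)) =
    (\<Sum>\<^sub>\<infinity>e\<in>edges_from M i. ennreal (prb M e y) * f e)"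
  unfolding nn_integral_count_space_infsum[OF countable_edges]
  by (rule infsum_cong_neutral) (auto simp: edges_from_def prb_off[OF assms])

lemma prb_sum: "(\<integral>\<^sup>+e. ennreal (prb M e y) \<partial>count_space (edges M)) = 1"
proof -
  obtain i where i: "i \<in> verts M" "y \<in> cell M i" using cells_cover by blast
  have "((\<lambda>e. wt M e y) has_sum 1) (edges_from M i)"
    using system i by (auto simp: countable_markov_system_def)
  then have "((\<lambda>e. prb M e y) has_sum 1) (edges M)"
    by (rule has_sum_cong_neutral[THEN iffD1, rotated -1])
       (use i in \<open>auto simp: edges_from_def prb_def prb_off dest: cell_unique[OF _ ini_vert]\<close>)
  from nn_integral_count_space_has_sum[OF this] show ?thesis by (simp add: prb_nonneg)
qed

text \<open>The law of the next edge from the state \<open>y\<close>. Every state lies in some cell, so the masses add up to one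
everywhere.\<close>

definition step :: "'a \<Rightarrow> 'e pmf" where
  "step y = embed_pmf (\<lambda>e. if e \<in> edges M then prb M e y else 0)"

lemma pmf_step: "pmf (step y) e = (if e \<in> edges M then prb M e y else 0)"
  unfolding step_def
proof (rule pmf_embed_pmf)
  have "(\<integral>\<^sup>+e. ennreal (if e \<in> edges M then prb M e y else 0) \<partial>count_space UNIV) =
    (\<integral>\<^sup>+e. ennreal (prb M e y) \<partial>count_space (edges M))"
    by (subst nn_integral_count_space_indicator)
       (auto intro!: nn_integral_cong split: split_indicator)
  then show "(\<integral>\<^sup>+e. ennreal (if e \<in> edges M then prb M e y else 0) \<partial>count_space UNIV) = 1"
    by (simp add: prb_sum)
qed (auto simp: prb_nonneg)

lemma set_step: "e \<in> set_pmf (step y) \<Longrightarrow> e \<in> edges M \<and> y \<in> cell M (ini M e)"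
  by (auto simp: set_pmf_iff pmf_step prb_def split: if_splits)

lemma nn_integral_step:
  assumes "y \<in> cell M i" "i \<in> verts M"
  shows "(\<integral>\<^sup>+e. f e \<partial>measure_pmf (step y)) = (\<Sum>\<^sub>\<infinity>e\<in>edges_from M i. ennreal (prb M e y) * f e)"
proof -
  have "(\<integral>\<^sup>+e. f e \<partial>measure_pmf (step y)) = (\<integral>\<^sup>+e. ennreal (pmf (step y) e) * f e \<partial>count_space UNIV)"
    by (rule nn_integral_measure_pmf)
  also have "\<dots> = (\<integral>\<^sup>+e. ennreal (prb M e y) * f e \<partial>count_space (edges M))"
    by (subst (2) nn_integral_count_space_indicator)
       (auto intro!: nn_integral_cong simp: pmf_step split: split_indicator)
  finally show ?thesis by (simp add: nn_integral_edges_from[OF assms])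
qed

primrec position :: "'e list \<Rightarrow> 'a" where
  "position [] = x 1"
| "position (e # h) = wmap M e (position h)"

primrec vertex :: "'e list \<Rightarrow> nat" where
  "vertex [] = 1"
| "vertex (e # h) = ter M e"

text \<open>Histories list the latest edge first, so \<open>hd h\<close> is the predecessor of \<open>e\<close>.\<close>

primrec linked :: "'e list \<Rightarrow> bool" where
  "linked [] \<longleftrightarrow> True"
| "linked (e # h) \<longleftrightarrow> linked h \<and> (h \<noteq> [] \<longrightarrow> ini M e = ter M (hd h))"

primrec history :: "nat \<Rightarrow> 'e list pmf" where
  "history 0 = return_pmf []"
| "history (Suc k) = bind_pmf (history k) (\<lambda>h. map_pmf (\<lambda>e. e # h) (step (position h)))"

lemma linked_take: "linked h \<Longrightarrow> linked (take l h)"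
  by (induction h arbitrary: l) (auto simp: take_Cons' hd_take)

lemma vertex_eq: "h \<noteq> [] \<Longrightarrow> vertex h = ter M (hd h)"
  by (cases h) auto

lemma history_support:
  "h \<in> set_pmf (history k) \<Longrightarrow> length h = k \<and> set h \<subseteq> edges M \<and> linked h \<and> vertex h \<in> verts M \<and> position h \<in> cell M (vertex h)"
proof (induction k arbitrary: h)
  case 0
  then show ?case using one_vert base_point by auto
next
  case (Suc k)
  then obtain e g where h: "h = e # g" "g \<in> set_pmf (history k)" "e \<in> set_pmf (step (position g))" by auto
  note IH = Suc.IH[OF h(2)]
  have e: "e \<in> edges M" "position g \<in> cell M (ini M e)" using set_step[OF h(3)] by auto
  then have "ini M e = vertex g" using IH cell_unique[OF ini_vert] by auto
  with IH e h show ?case by (auto simp: ter_vert wmap_cell vertex_eq)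
qed

lemma step_ini:
  assumes "h \<in> set_pmf (history k)" "e \<in> set_pmf (step (position h))"
  shows "e \<in> edges M" "ini M e = vertex h"
  using set_step[OF assms(2)] history_support[OF assms(1)] cell_unique[OF ini_vert] by auto

lemma map_drop_history: "map_pmf (drop m) (history (k + m)) = history k"
proof (induction m)
  case 0
  then show ?case by (simp add: drop_0[abs_def] map_pmf_ident)
next
  case (Suc m)
  have "map_pmf tl (history (Suc n)) = history n" for n
    by (simp add: map_bind_pmf pmf.map_comp o_def bind_return_pmf')
  then have "map_pmf tl (history (Suc (k + m))) = history (k + m)" .
  then have "map_pmf (drop m) (map_pmf tl (history (Suc (k + m)))) = history k"
    by (simp only: Suc)
  then show ?case by (simp add: pmf.map_comp o_def drop_Suc[abs_def])
qed

section \<open>Contraction along histories\<close>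

text \<open>The point reconstructed from a word alone: its maps are applied to the base point of the cell where
its oldest edge starts. It equals the backward orbit of a path at the corresponding time.\<close>

definition backward_point :: "'e list \<Rightarrow> 'a" where
  "backward_point v = foldr (wmap M) v (x (ini M (last v)))"

text \<open>The same, from the last \<open>l\<close> edges of a history. No edge determines the starting cell if \<open>l = 0\<close>; the
current vertex does.\<close>

definition recalled :: "nat \<Rightarrow> 'e list \<Rightarrow> 'a" where
  "recalled l h = (if l = 0 then x (vertex h) else backward_point (take l h))"

lemma recalled_Cons:
  assumes "ini M e = vertex h" "l \<le> length h"
  shows "recalled (Suc l) (e # h) = wmap M e (recalled l h)"
  using assms by (cases h) (auto simp: recalled_def backward_point_def)

lemma recalled_cell:
  assumes "linked h" "set h \<subseteq> edges M" "l \<le> length h" "l = 0 \<Longrightarrow> vertex h \<in> verts M"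
  shows "recalled l h \<in> cell M (vertex h)"
proof (cases "l = 0")
  case True
  then show ?thesis using assms by (auto simp: recalled_def base_point)
next
  case False
  have "v \<noteq> [] \<Longrightarrow> linked v \<Longrightarrow> set v \<subseteq> edges M \<Longrightarrow> backward_point v \<in> cell M (vertex v)" for v
    by (induction v) (auto simp: backward_point_def wmap_cell base_point ini_vert vertex_eq)
  moreover have "linked (take l h)" by (rule linked_take[OF assms(1)])
  moreover have "take l h \<noteq> []" "vertex (take l h) = vertex h" "set (take l h) \<subseteq> edges M"
    using False assms set_take_subset[of l h] by (cases h; cases l; auto)+
  ultimately show ?thesis using False by (metis recalled_def)
qed

text \<open>Contraction on average holds for two points of the same cell, weighted by the probabilities at the first
of them; here that is the actual state, so the weights are the true law of the next edge.\<close>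

lemma dist_backward_point_step:
  assumes "h \<in> set_pmf (history k)" "contractive_with_rate M a" "z \<in> cell M (vertex h)" "0 \<le> a"
  shows "(\<integral>\<^sup>+e. ennreal (dist (wmap M e (position h)) (wmap M e z)) \<partial>measure_pmf (step (position h))) \<le> ennreal a * ennreal (dist (position h) z)"
proof -
  note h = history_support[OF assms(1)]
  have "(\<integral>\<^sup>+e. ennreal (dist (wmap M e (position h)) (wmap M e z)) \<partial>measure_pmf (step (position h)))
      = (\<Sum>\<^sub>\<infinity>e\<in>edges_from M (vertex h). ennreal (prb M e (position h)) * ennreal (dist (wmap M e (position h)) (wmap M e z)))"
    using h by (intro nn_integral_step) auto
  also have "\<dots> = (\<Sum>\<^sub>\<infinity>e\<in>edges_from M (vertex h). ennreal (prb M e (position h) * dist (wmap M e (position h)) (wmap M e z)))"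
    by (intro infsum_cong) (auto simp: edges_from_def prb_nonneg ennreal_mult)
  also have "\<dots> \<le> ennreal (a * dist (position h) z)"
    using assms h unfolding contractive_with_rate_def by blast
  finally show ?thesis using assms(4) by (simp add: ennreal_mult)
qed

text \<open>The mean error, at time \<open>k\<close>, of reconstructing the state of the chain from its last \<open>l\<close> edges.\<close>

definition gap :: "nat \<Rightarrow> nat \<Rightarrow> ennreal" where
  "gap l k = (\<integral>\<^sup>+h. ennreal (dist (position h) (recalled l h)) \<partial>measure_pmf (history k))"

lemma gap_Suc:
  assumes "contractive_with_rate M a" "0 \<le> a" "l \<le> k"
  shows "gap (Suc l) (Suc k) \<le> ennreal a * gap l k"
proof -
  have "gap (Suc l) (Suc k) = (\<integral>\<^sup>+h. \<integral>\<^sup>+e. ennreal (dist (wmap M e (position h)) (recalled (Suc l) (e # h))) \<partial>measure_pmf (step (position h)) \<partial>measure_pmf (history k))"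
    by (simp add: gap_def)
  also have "\<dots> \<le> (\<integral>\<^sup>+h. ennreal a * ennreal (dist (position h) (recalled l h)) \<partial>measure_pmf (history k))"
  proof (rule nn_integral_mono_AE, subst AE_measure_pmf_iff, intro ballI)
    fix h assume h: "h \<in> set_pmf (history k)"
    note hs = history_support[OF h]
    have "(\<integral>\<^sup>+e. ennreal (dist (wmap M e (position h)) (recalled (Suc l) (e # h))) \<partial>measure_pmf (step (position h)))
        = (\<integral>\<^sup>+e. ennreal (dist (wmap M e (position h)) (wmap M e (recalled l h))) \<partial>measure_pmf (step (position h)))"
      by (rule nn_integral_cong_AE, subst AE_measure_pmf_iff)
         (use step_ini[OF h] hs assms(3) in \<open>simp add: recalled_Cons\<close>)
    also have "\<dots> \<le> ennreal a * ennreal (dist (position h) (recalled l h))"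
      by (rule dist_backward_point_step[OF h assms(1)]) (use hs assms in \<open>auto intro!: recalled_cell\<close>)
    finally show "(\<integral>\<^sup>+e. ennreal (dist (wmap M e (position h)) (recalled (Suc l) (e # h))) \<partial>measure_pmf (step (position h))) \<le> \<dots>" .
  qed
  also have "\<dots> = ennreal a * gap l k"
    by (simp add: gap_def nn_integral_cmult)
  finally show ?thesis .
qed

text \<open>The next state and the next base point are compared through the image of the present base point: the
first distance contracts and the second is on average at most $b$.\<close>

lemma gap_0_Suc:
  assumes "contractive_with_rate M a" "0 \<le> a"
  shows "gap 0 (Suc k) \<le> ennreal a * gap 0 k + base_const M x"
proof -
  have "gap 0 (Suc k) = (\<integral>\<^sup>+h. \<integral>\<^sup>+e. ennreal (dist (wmap M e (position h)) (x (ter M e))) \<partial>measure_pmf (step (position h)) \<partial>measure_pmf (history k))"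
    by (simp add: gap_def recalled_def)
  also have "\<dots> \<le> (\<integral>\<^sup>+h. ennreal a * ennreal (dist (position h) (recalled 0 h)) + base_const M x \<partial>measure_pmf (history k))"
  proof (rule nn_integral_mono_AE, subst AE_measure_pmf_iff, intro ballI)
    fix h assume h: "h \<in> set_pmf (history k)"
    note hs = history_support[OF h]
    have "(\<integral>\<^sup>+e. ennreal (dist (wmap M e (position h)) (x (ter M e))) \<partial>measure_pmf (step (position h)))
       \<le> (\<integral>\<^sup>+e. ennreal (dist (wmap M e (position h)) (wmap M e (x (vertex h)))) + ennreal (dist (wmap M e (x (ini M e))) (x (ter M e))) \<partial>measure_pmf (step (position h)))"
      by (rule nn_integral_mono_AE, subst AE_measure_pmf_iff)
         (use step_ini[OF h] in \<open>auto simp flip: ennreal_plus intro!: dist_triangle\<close>)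
    also have "\<dots> = (\<integral>\<^sup>+e. ennreal (dist (wmap M e (position h)) (wmap M e (x (vertex h)))) \<partial>measure_pmf (step (position h)))
        + (\<integral>\<^sup>+e. ennreal (dist (wmap M e (x (ini M e))) (x (ter M e))) \<partial>measure_pmf (step (position h)))"
      by (rule nn_integral_add) auto
    also have "\<dots> \<le> ennreal a * ennreal (dist (position h) (recalled 0 h)) + base_const M x"
    proof (rule add_mono)
      show "(\<integral>\<^sup>+e. ennreal (dist (wmap M e (position h)) (wmap M e (x (vertex h)))) \<partial>measure_pmf (step (position h))) \<le> ennreal a * ennreal (dist (position h) (recalled 0 h))"
        using dist_backward_point_step[OF h assms(1) _ assms(2), of "x (vertex h)"] hs by (simp add: recalled_def base_point)
      have "(\<integral>\<^sup>+e. ennreal (dist (wmap M e (x (ini M e))) (x (ter M e))) \<partial>measure_pmf (step (position h)))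
          = (\<Sum>\<^sub>\<infinity>e\<in>edges_from M (vertex h). ennreal (prb M e (position h)) * ennreal (dist (wmap M e (x (ini M e))) (x (ter M e))))"
        using hs by (intro nn_integral_step) auto
      also have "\<dots> = (\<Sum>\<^sub>\<infinity>e\<in>edges_from M (vertex h). ennreal (prb M e (position h) * dist (wmap M e (x (ini M e))) (x (ter M e))))"
        by (intro infsum_cong) (auto simp: edges_from_def prb_nonneg ennreal_mult)
      also have "\<dots> \<le> base_const M x"
        unfolding base_const_def using hs by (intro SUP_upper2[of "vertex h"] SUP_upper2[of "position h"]) auto
      finally show "(\<integral>\<^sup>+e. ennreal (dist (wmap M e (x (ini M e))) (x (ter M e))) \<partial>measure_pmf (step (position h))) \<le> base_const M x" .
    qed
    finally show "(\<integral>\<^sup>+e. ennreal (dist (wmap M e (position h)) (x (ter M e))) \<partial>measure_pmf (step (position h))) \<le> \<dots>" .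
  qed
  also have "\<dots> = ennreal a * gap 0 k + base_const M x"
    by (simp add: gap_def nn_integral_add nn_integral_cmult)
  finally show ?thesis .
qed

text \<open>The recursion $z_{k+1} \le a z_k + b$ with $z_0 = 0$ stays below its fixed point $b/(1-a)$, and each
further recalled edge gains a factor $a$.\<close>

lemma gap_bound:
  assumes "contractive_with_rate M a" "0 < a" "a < 1" "base_const M x < \<infinity>"
  obtains C where "0 \<le> C" "\<And>l k. l \<le> k \<Longrightarrow> gap l k \<le> ennreal (C * a ^ l)"
proof -
  obtain b where b: "base_const M x = ennreal b" "0 \<le> b"
    using assms(4) by (cases "base_const M x") auto
  define C where "C = b / (1 - a)"
  have C: "0 \<le> C" "a * C + b = C" using b assms by (auto simp: C_def field_simps)
  have g0: "gap 0 k \<le> ennreal C" for k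
  proof (induction k)
    case 0
    then show ?case by (simp add: gap_def recalled_def)
  next
    case (Suc k)
    have "gap 0 (Suc k) \<le> ennreal a * ennreal C + ennreal b"
      using assms b Suc by (intro order_trans[OF gap_0_Suc[of a]] add_mono mult_left_mono) auto
    also have "\<dots> = ennreal C" using C b assms by (simp flip: ennreal_mult ennreal_plus)
    finally show ?case .
  qed
  have "l \<le> k \<Longrightarrow> gap l k \<le> ennreal (C * a ^ l)" for l k
  proof (induction l arbitrary: k)
    case 0
    then show ?case using g0 by simp
  next
    case (Suc l)
    then obtain k' where k: "k = Suc k'" "l \<le> k'" by (cases k) auto
    have "gap (Suc l) k \<le> ennreal a * ennreal (C * a ^ l)"
      unfolding k(1) using assms k Suc.IH[OF k(2)]
      by (intro order_trans[OF gap_Suc[of a]] mult_left_mono) auto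
    also have "\<dots> = ennreal (C * a ^ Suc l)" using C assms by (simp flip: ennreal_mult add: ac_simps)
    finally show ?case .
  qed
  with C(1) show ?thesis by (rule that)
qed

end

section \<open>Tightness and the limit of averaged histories\<close>

context coded_system
begin

definition edge_sup :: "'e \<Rightarrow> ennreal" where
  "edge_sup e = (SUP y\<in>cell M (ini M e). ennreal (prb M e y))"

text \<open>The summands of \<^const>\<open>dom_const\<close>: a bound, uniform in the present state, for the probability of moving to
vertex \<open>j\<close>.\<close>

definition inflow :: "nat \<Rightarrow> ennreal" where
  "inflow j = (SUP i\<in>verts M. dom_mass M i * dom_trans M i j)"

lemma dom_mass_eq: "dom_mass M i = (\<Sum>\<^sub>\<infinity>e\<in>edges_from M i. edge_sup e)"
  unfolding dom_mass_def by (rule infsum_cong) (auto simp: edges_from_def edge_sup_def)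

lemma emeasure_step_le:
  assumes "y \<in> cell M i" "i \<in> verts M"
  shows "emeasure (measure_pmf (step y)) A \<le> (\<Sum>\<^sub>\<infinity>e\<in>edges_from M i \<inter> A. edge_sup e)"
proof -
  have "emeasure (measure_pmf (step y)) A = (\<integral>\<^sup>+e. indicator A e \<partial>measure_pmf (step y))" by simp
  also have "\<dots> = (\<Sum>\<^sub>\<infinity>e\<in>edges_from M i. ennreal (prb M e y) * indicator A e)"
    by (rule nn_integral_step[OF assms])
  also have "\<dots> = (\<Sum>\<^sub>\<infinity>e\<in>edges_from M i \<inter> A. ennreal (prb M e y))"
    by (rule infsum_cong_neutral) auto
  also have "\<dots> \<le> (\<Sum>\<^sub>\<infinity>e\<in>edges_from M i \<inter> A. edge_sup e)"
    by (intro infsum_mono nonneg_summable_on_complete)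
       (use assms in \<open>auto simp: edge_sup_def edges_from_def intro!: SUP_upper\<close>)
  finally show ?thesis .
qed

text \<open>The normalisation in \<^const>\<open>dom_trans\<close> cancels, since \<open>1 \<le> dom_mass M i < \<infinity>\<close>: the suprema of the
weights dominate a probability distribution.\<close>

lemma emeasure_step_ter:
  assumes "has_dominating_chain M" "y \<in> cell M i" "i \<in> verts M"
  shows "emeasure (measure_pmf (step y)) {e. ter M e = j} \<le> inflow j"
proof -
  have "1 \<le> dom_mass M i"
    using emeasure_step_le[OF assms(2,3), of UNIV] by (simp add: dom_mass_eq)
  moreover have "dom_mass M i < \<infinity>"
    using assms by (auto simp: has_dominating_chain_def)
  ultimately have "dom_mass M i * dom_trans M i j = (\<Sum>\<^sub>\<infinity>e\<in>{e\<in>edges_from M i. ter M e = j}. SUP x\<in>cell M i. ennreal (prb M e x))"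
    unfolding dom_trans_def ennreal_times_divide mult.commute[of "dom_mass M i"]
    by (intro ennreal_mult_divide_eq) auto
  also have "\<dots> = (\<Sum>\<^sub>\<infinity>e\<in>edges_from M i \<inter> {e. ter M e = j}. edge_sup e)"
    by (rule infsum_cong_neutral) (auto simp: edges_from_def edge_sup_def)
  finally have eq: "dom_mass M i * dom_trans M i j = (\<Sum>\<^sub>\<infinity>e\<in>edges_from M i \<inter> {e. ter M e = j}. edge_sup e)" .
  have "(\<Sum>\<^sub>\<infinity>e\<in>edges_from M i \<inter> {e. ter M e = j}. edge_sup e) \<le> inflow j"
    unfolding inflow_def eq[symmetric] by (rule SUP_upper[OF assms(3)])
  with emeasure_step_le[OF assms(2,3)] show ?thesis by (rule order_trans)
qed

lemma emeasure_step_ter_outside: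
  assumes "has_dominating_chain M"
  shows "emeasure (measure_pmf (step y)) {e. ter M e \<notin> J} \<le> (\<Sum>\<^sub>\<infinity>j\<in>verts M - J. inflow j)"
proof -
  obtain i where i: "i \<in> verts M" "y \<in> cell M i" using cells_cover by blast
  have "emeasure (measure_pmf (step y)) {e. ter M e \<notin> J} = emeasure (measure_pmf (step y)) (\<Union>j\<in>verts M - J. {e. ter M e = j})"
    by (rule emeasure_eq_AE) (auto simp: AE_measure_pmf_iff ter_vert dest: set_step)
  also have "\<dots> = (\<integral>\<^sup>+j. emeasure (measure_pmf (step y)) {e. ter M e = j} \<partial>count_space (verts M - J))"
    by (rule emeasure_UN_countable) (auto simp: disjoint_family_on_def)
  also have "\<dots> = (\<Sum>\<^sub>\<infinity>j\<in>verts M - J. emeasure (measure_pmf (step y)) {e. ter M e = j})"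
    by (rule nn_integral_count_space_infsum) simp
  also have "\<dots> \<le> (\<Sum>\<^sub>\<infinity>j\<in>verts M - J. inflow j)"
    by (intro infsum_mono nonneg_summable_on_complete emeasure_step_ter[OF assms i(2,1)]) auto
  finally show ?thesis .
qed

lemma emeasure_history_Suc:
  "emeasure (measure_pmf (history (Suc k))) A = (\<integral>\<^sup>+h. emeasure (measure_pmf (step (position h))) {e. e # h \<in> A} \<partial>measure_pmf (history k))"
  by (simp add: vimage_def)

lemma history_vertex_tail:
  assumes "has_dominating_chain M"
  shows "emeasure (measure_pmf (history (Suc k))) {h. vertex h \<notin> J} \<le> (\<Sum>\<^sub>\<infinity>j\<in>verts M - J. inflow j)"
proof -
  have "emeasure (measure_pmf (history (Suc k))) {h. vertex h \<notin> J} \<le> (\<integral>\<^sup>+h. (\<Sum>\<^sub>\<infinity>j\<in>verts M - J. inflow j) \<partial>measure_pmf (history k))"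
    unfolding emeasure_history_Suc
    by (intro nn_integral_mono) (simp add: emeasure_step_ter_outside[OF assms])
  then show ?thesis by simp
qed

text \<open>The edge falls outside \<open>A\<close> because the current vertex is outside \<open>J\<close>, or in spite of a
vertex in \<open>J\<close>. Two steps are needed, since the vertex bound already uses one.\<close>

lemma history_edge_tail:
  assumes "has_dominating_chain M" "finite J"
  shows "emeasure (measure_pmf (history (Suc (Suc k)))) {h. hd h \<notin> A} \<le>
    (\<Sum>\<^sub>\<infinity>j\<in>verts M - J. inflow j) + (\<Sum>j\<in>J. \<Sum>\<^sub>\<infinity>e\<in>edges_from M j - A. edge_sup e)"
    (is "_ \<le> _ + ?S")
proof -
  have "emeasure (measure_pmf (history (Suc (Suc k)))) {h. hd h \<notin> A} \<le>
    (\<integral>\<^sup>+h. indicator {h. vertex h \<notin> J} h + ?S \<partial>measure_pmf (history (Suc k)))"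
    unfolding emeasure_history_Suc[of "Suc k"]
  proof (rule nn_integral_mono_AE, subst AE_measure_pmf_iff, intro ballI)
    fix h assume "h \<in> set_pmf (history (Suc k))"
    note h = history_support[OF this]
    show "emeasure (measure_pmf (step (position h))) {e. e # h \<in> {h. hd h \<notin> A}} \<le> indicator {h. vertex h \<notin> J} h + ?S"
    proof (cases "vertex h \<in> J")
      case True
      have "emeasure (measure_pmf (step (position h))) {e. e \<notin> A} \<le> (\<Sum>\<^sub>\<infinity>e\<in>edges_from M (vertex h) \<inter> {e. e \<notin> A}. edge_sup e)"
        using h by (intro emeasure_step_le) auto
      also have "edges_from M (vertex h) \<inter> {e. e \<notin> A} = edges_from M (vertex h) - A" by auto
      also have "(\<Sum>\<^sub>\<infinity>e\<in>edges_from M (vertex h) - A. edge_sup e) \<le> ?S"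
        using member_le_sum[OF True _ assms(2), of "\<lambda>j. \<Sum>\<^sub>\<infinity>e\<in>edges_from M j - A. edge_sup e"] by simp
      finally show ?thesis using True by simp
    next
      case False
      have "emeasure (measure_pmf (step (position h))) {e. e # h \<in> {h. hd h \<notin> A}} \<le> 1 + ?S"
        by (rule order_trans[OF measure_pmf.emeasure_le_1]) simp
      then show ?thesis using False by simp
    qed
  qed
  also have "\<dots> = emeasure (measure_pmf (history (Suc k))) {h. vertex h \<notin> J} + ?S"
    by (subst nn_integral_add) (simp_all del: history.simps)
  also have "\<dots> \<le> (\<Sum>\<^sub>\<infinity>j\<in>verts M - J. inflow j) + ?S"
    by (intro add_mono history_vertex_tail assms) simp
  finally show ?thesis .
qed

lemma last_edge_tight:
  assumes dom: "has_dominating_chain M" "dom_const M < \<infinity>" and "\<epsilon> > 0"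
  obtains A where "finite A" "\<And>k. 2 \<le> k \<Longrightarrow> measure_pmf.prob (history k) {h. hd h \<notin> A} \<le> \<epsilon>"
proof -
  have e2: "ennreal (\<epsilon> / 2) > 0" using \<open>\<epsilon> > 0\<close> by simp
  have "(\<Sum>\<^sub>\<infinity>j\<in>verts M. inflow j) < \<infinity>"
    using dom(2) by (simp add: dom_const_def inflow_def)
  from infsum_small_tail[OF this e2] obtain J
    where J: "finite J" "J \<subseteq> verts M" "(\<Sum>\<^sub>\<infinity>j\<in>verts M - J. inflow j) \<le> ennreal (\<epsilon> / 2)" .
  define \<eta> where "\<eta> = \<epsilon> / 2 / (card J + 1)"
  have \<eta>: "\<eta> > 0" "card J * \<eta> \<le> \<epsilon> / 2" using \<open>\<epsilon> > 0\<close> by (auto simp: \<eta>_def field_simps)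
  have "\<forall>j\<in>J. \<exists>B. finite B \<and> (\<Sum>\<^sub>\<infinity>e\<in>edges_from M j - B. edge_sup e) \<le> ennreal \<eta>"
  proof
    fix j assume "j \<in> J"
    then have "(\<Sum>\<^sub>\<infinity>e\<in>edges_from M j. edge_sup e) < \<infinity>"
      using J(2) dom(1) unfolding has_dominating_chain_def dom_mass_eq by blast
    with \<eta>(1) show "\<exists>B. finite B \<and> (\<Sum>\<^sub>\<infinity>e\<in>edges_from M j - B. edge_sup e) \<le> ennreal \<eta>"
      by (metis infsum_small_tail ennreal_less_zero_iff)
  qed
  then obtain B where B: "\<And>j. j \<in> J \<Longrightarrow> finite (B j)"
      "\<And>j. j \<in> J \<Longrightarrow> (\<Sum>\<^sub>\<infinity>e\<in>edges_from M j - B j. edge_sup e) \<le> ennreal \<eta>"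
    by metis
  define A where "A = (\<Union>j\<in>J. B j)"
  have sumA: "(\<Sum>j\<in>J. \<Sum>\<^sub>\<infinity>e\<in>edges_from M j - A. edge_sup e) \<le> ennreal (\<epsilon> / 2)"
  proof -
    have "(\<Sum>\<^sub>\<infinity>e\<in>edges_from M j - A. edge_sup e) \<le> ennreal \<eta>" if "j \<in> J" for j
      by (rule order_trans[OF infsum_mono_neutral B(2)[OF that]])
         (use that in \<open>auto simp: A_def intro!: nonneg_summable_on_complete\<close>)
    then have "(\<Sum>j\<in>J. \<Sum>\<^sub>\<infinity>e\<in>edges_from M j - A. edge_sup e) \<le> (\<Sum>j\<in>J. ennreal \<eta>)"
      by (rule sum_mono)
    also have "\<dots> = ennreal (card J * \<eta>)" using \<eta>(1) by (simp add: ennreal_mult ennreal_of_nat_eq_real_of_nat)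
    also have "\<dots> \<le> ennreal (\<epsilon> / 2)" by (rule ennreal_leI[OF \<eta>(2)])
    finally show ?thesis .
  qed
  show ?thesis
  proof (rule that[of A])
    show "finite A" using J B by (auto simp: A_def)
    fix k :: nat assume "2 \<le> k"
    then obtain n where k: "k = Suc (Suc n)" by (metis add_2_eq_Suc le_Suc_ex)
    have "emeasure (measure_pmf (history k)) {h. hd h \<notin> A} \<le> ennreal (\<epsilon> / 2) + ennreal (\<epsilon> / 2)"
      unfolding k by (rule order_trans[OF history_edge_tail[OF dom(1) J(1)] add_mono[OF J(3) sumA]])
    also have "\<dots> = ennreal \<epsilon>" using \<open>\<epsilon> > 0\<close> by (simp flip: ennreal_plus)
    finally show "measure_pmf.prob (history k) {h. hd h \<notin> A} \<le> \<epsilon>"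
      using \<open>\<epsilon> > 0\<close> by (simp add: measure_pmf.emeasure_eq_measure)
  qed
qed

text \<open>A word leaves the finite set as soon as one of its \<open>l\<close> letters leaves \<open>A\<close>, and every
letter is the last edge of an earlier history.\<close>

lemma words_tight:
  assumes dom: "has_dominating_chain M" "dom_const M < \<infinity>" and "\<epsilon> > 0"
  obtains W where "finite W" "\<And>k. l + 2 \<le> k \<Longrightarrow> measure_pmf.prob (history k) {h. take l h \<notin> W} \<le> \<epsilon>"
proof -
  define \<eta> where "\<eta> = \<epsilon> / (l + 1)"
  have \<eta>: "\<eta> > 0" "l * \<eta> \<le> \<epsilon>" using \<open>\<epsilon> > 0\<close> by (auto simp: \<eta>_def field_simps)
  obtain A where A: "finite A" "\<And>k. 2 \<le> k \<Longrightarrow> measure_pmf.prob (history k) {h. hd h \<notin> A} \<le> \<eta>"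
    using last_edge_tight[OF dom \<eta>(1)] by blast
  show ?thesis
  proof (rule that[of "{v. set v \<subseteq> A \<and> length v \<le> l}"])
    show "finite {v. set v \<subseteq> A \<and> length v \<le> l}" by (rule finite_lists_length_le[OF A(1)])
    fix k assume k: "l + 2 \<le> k"
    have letter: "measure_pmf.prob (history k) {h. hd (drop m h) \<notin> A} \<le> \<eta>" if "m < l" for m
    proof -
      have "measure_pmf.prob (history k) {h. hd (drop m h) \<notin> A} = measure_pmf.prob (map_pmf (drop m) (history (k - m + m))) {h. hd h \<notin> A}"
        using that k by (simp add: measure_map_pmf vimage_def)
      also have "\<dots> \<le> \<eta>" unfolding map_drop_history using that k by (intro A(2)) auto
      finally show ?thesis .
    qed
    have "measure_pmf.prob (history k) {h. take l h \<notin> {v. set v \<subseteq> A \<and> length v \<le> l}}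
        \<le> measure_pmf.prob (history k) (\<Union>m\<in>{..<l}. {h. hd (drop m h) \<notin> A})"
    proof (rule measure_pmf.finite_measure_mono_AE, subst AE_measure_pmf_iff, intro ballI impI)
      fix h assume "h \<in> set_pmf (history k)" and out: "h \<in> {h. take l h \<notin> {v. set v \<subseteq> A \<and> length v \<le> l}}"
      then have len: "length h = k" using history_support by blast
      from out obtain e where "e \<in> set (take l h)" "e \<notin> A" by auto
      then obtain m where "m < l" "m < length h" "h ! m \<notin> A" by (auto simp: in_set_conv_nth)
      then show "h \<in> (\<Union>m\<in>{..<l}. {h. hd (drop m h) \<notin> A})" by (auto simp: hd_drop_conv_nth intro!: bexI[of _ m])
    qed simp
    also have "\<dots> \<le> (\<Sum>m<l. measure_pmf.prob (history k) {h. hd (drop m h) \<notin> A})"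
      by (rule measure_pmf.finite_measure_subadditive_finite) auto
    also have "\<dots> \<le> (\<Sum>m<l. \<eta>)" by (intro sum_mono letter) simp
    also have "\<dots> \<le> \<epsilon>" using \<eta>(2) by simp
    finally show "measure_pmf.prob (history k) {h. take l h \<notin> {v. set v \<subseteq> A \<and> length v \<le> l}} \<le> \<epsilon>" .
  qed
qed

text \<open>The averaging times \<open>N, \<dots>, 2 * N\<close> all move to infinity, so that every history that occurs is
long enough for the words under consideration and for the tightness bounds.\<close>

definition avg_history :: "nat \<Rightarrow> 'e list pmf" where
  "avg_history N = bind_pmf (pmf_of_set {N..2 * N}) history"

lemma expectation_avg_history:
  fixes f :: "'e list \<Rightarrow> real"
  assumes "\<And>h. \<bar>f h\<bar> \<le> B"
  shows "measure_pmf.expectation (avg_history N) f = (\<Sum>k=N..2*N. measure_pmf.expectation (history k) f) / (N + 1)"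
proof -
  have "measure_pmf.expectation (avg_history N) f = measure_pmf.expectation (pmf_of_set {N..2*N}) (\<lambda>k. measure_pmf.expectation (history k) f)"
    unfolding avg_history_def by (subst measure_pmf_bind, subst integral_bind[where K="count_space UNIV" and B=B and B'=1])
      (use assms in \<open>auto simp: measure_pmf_in_subprob_algebra\<close>)
  then show ?thesis by (simp add: integral_pmf_of_set)
qed

lemma expectation_avg_history_le:
  fixes f :: "'e list \<Rightarrow> real"
  assumes "\<And>h. \<bar>f h\<bar> \<le> B" "\<And>k. N \<le> k \<Longrightarrow> measure_pmf.expectation (history k) f \<le> c"
  shows "measure_pmf.expectation (avg_history N) f \<le> c"
proof -
  have "(\<Sum>k=N..2*N. measure_pmf.expectation (history k) f) \<le> (\<Sum>k=N..2*N. c)"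
    by (intro sum_mono assms(2)) simp
  then show ?thesis
    by (simp add: expectation_avg_history[OF assms(1)] field_simps)
qed

text \<open>Averages over a long stretch of times and over its translate by one differ by a telescoping sum. This is the source
of stationarity.\<close>

lemma averaged_shift_tendsto_0:
  fixes c :: "nat \<Rightarrow> real"
  assumes "\<And>k. \<bar>c k\<bar> \<le> B"
  shows "(\<lambda>N. (\<Sum>k=N..2*N. c k) / (N + 1) - (\<Sum>k=N..2*N. c (Suc k)) / (N + 1)) \<longlonglongrightarrow> 0"
proof (rule tendsto_rabs_zero_cancel, rule tendsto_sandwich[where f="\<lambda>_. 0" and h="\<lambda>N. 2 * B / (real N + 1)"])
  show "(\<lambda>N. 2 * B / (real N + 1)) \<longlonglongrightarrow> 0" by real_asymp
  have "\<bar>(\<Sum>k=N..2*N. c k) / (N + 1) - (\<Sum>k=N..2*N. c (Suc k)) / (N + 1)\<bar> \<le> 2 * B / (real N + 1)" for N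
  proof -
    have "(\<Sum>k=N..2*N. c k) - (\<Sum>k=N..2*N. c (Suc k)) = c N - c (Suc (2 * N))"
      using sum_Suc_diff'[of N "Suc (2 * N)" c] by (simp add: sum_subtractf atLeastLessThanSuc_atLeastAtMost)
    moreover have "\<bar>c N - c (Suc (2 * N))\<bar> \<le> 2 * B"
      using assms[of N] assms[of "Suc (2 * N)"] by linarith
    ultimately show ?thesis by (simp add: divide_right_mono add.commute flip: diff_divide_distrib)
  qed
  then show "\<forall>\<^sub>F N in sequentially. \<bar>(\<Sum>k=N..2*N. c k) / (N + 1) - (\<Sum>k=N..2*N. c (Suc k)) / (N + 1)\<bar> \<le> 2 * B / (real N + 1)"
    by simp
qed simp_all

lemma avg_history_support: "h \<in> set_pmf (avg_history N) \<Longrightarrow> N \<le> length h \<and> set h \<subseteq> edges M \<and> linked h"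
  using history_support by (fastforce simp: avg_history_def)

end

text \<open>The word laws \<open>q\<close> are limits of the averaged chain along the filter \<open>G\<close>, tested on bounded functions.\<close>

locale limit_words = coded_system M x + stationary_words q
  for M :: "('a::complete_space, 'e) markov_system" and x and q :: "nat \<Rightarrow> 'e list pmf" +
  fixes G :: "nat filter"
  assumes G: "G \<noteq> bot" "G \<le> sequentially"
    and lim: "\<And>l (f :: 'e list \<Rightarrow> real) B. (\<And>v. \<bar>f v\<bar> \<le> B) \<Longrightarrow>
      ((\<lambda>N. measure_pmf.expectation (avg_history N) (\<lambda>h. f (take l h))) \<longlongrightarrow> measure_pmf.expectation (q l) f) G"

context coded_system
begin

text \<open>Tightness makes the pointwise limits of the word probabilities into laws, for each length separately.
Consistency is inherited from the averages; stationarity holds since the averages are asymptotically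
invariant under a time step.\<close>

lemma limit_words_exist:
  assumes dom: "has_dominating_chain M" "dom_const M < \<infinity>"
  shows "\<exists>q G. limit_words M x q G"
proof -
  define p where "p l N = map_pmf (take l) (avg_history N)" for l N
  obtain G L where G: "G \<noteq> bot" "G \<le> sequentially"
    and L: "\<And>w. ((\<lambda>N. pmf (p (length w) N) w) \<longlongrightarrow> L w) G"
    by (rule pointwise_limit_along_filter[of "\<lambda>N w. pmf (p (length w) N) w"]) (auto simp: pmf_le_1)
  have evG: "eventually P sequentially \<Longrightarrow> eventually P G" for P
    using G(2) by (rule filter_leD)
  \<comment> \<open>Words of another length have no mass once the histories are longer than \<open>l\<close>.\<close>
  define f where "f l w = (if length w = l then L w else 0)" for l w
  have plim: "((\<lambda>N. pmf (p l N) w) \<longlongrightarrow> f l w) G" for l w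
  proof (cases "length w = l")
    case False
    have "\<forall>\<^sub>F N in sequentially. pmf (p l N) w = 0"
      using eventually_ge_at_top[of l]
    proof eventually_elim
      case (elim N)
      then have "w \<notin> set_pmf (p l N)" using False avg_history_support by (fastforce simp: p_def)
      then show ?case by (simp add: set_pmf_iff)
    qed
    then have "((\<lambda>N. pmf (p l N) w) \<longlongrightarrow> 0) G" by (intro tendsto_eventually evG)
    with False show ?thesis by (simp add: f_def)
  qed (use L in \<open>auto simp: f_def\<close>)
  have tight: "\<exists>W. finite W \<and> (\<forall>\<^sub>F N in G. measure_pmf.prob (p l N) (- W) \<le> \<epsilon>)" if pos: "\<epsilon> > 0" for l \<epsilon>
  proof -
    obtain W where W: "finite W" "\<And>k. l + 2 \<le> k \<Longrightarrow> measure_pmf.prob (history k) {h. take l h \<notin> W} \<le> \<epsilon>"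
      using words_tight[OF dom pos] by blast
    have "\<forall>\<^sub>F N in sequentially. measure_pmf.prob (p l N) (- W) \<le> \<epsilon>"
      using eventually_ge_at_top[of "l + 2"]
    proof eventually_elim
      case (elim N)
      have "measure_pmf.prob (p l N) (- W) = measure_pmf.expectation (avg_history N) (indicator {h. take l h \<notin> W})"
        by (simp add: p_def measure_map_pmf vimage_def Compl_eq)
      also have "\<dots> \<le> \<epsilon>"
        by (rule expectation_avg_history_le[where B=1]) (use elim W(2) in \<open>auto simp: indicator_def\<close>)
      finally show ?case .
    qed
    with W(1) evG show ?thesis by blast
  qed
  have "\<exists>r. (\<forall>w. pmf r w = f l w) \<and> (\<forall>(g :: 'e list \<Rightarrow> real) B. (\<forall>v. \<bar>g v\<bar> \<le> B) \<longrightarrow>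
      ((\<lambda>N. measure_pmf.expectation (p l N) g) \<longlongrightarrow> measure_pmf.expectation r g) G)" for l
    by (rule tight_pmf_limit[OF G(1) plim[of l] tight[of _ l]]) blast+
  then obtain q where q: "\<And>l w. pmf (q l) w = f l w"
    and lim: "\<And>l (g :: 'e list \<Rightarrow> real) B. (\<And>v. \<bar>g v\<bar> \<le> B) \<Longrightarrow>
      ((\<lambda>N. measure_pmf.expectation (p l N) g) \<longlongrightarrow> measure_pmf.expectation (q l) g) G"
    by metis
  have lim': "((\<lambda>N. measure_pmf.expectation (avg_history N) (\<lambda>h. g (take l h))) \<longlongrightarrow> measure_pmf.expectation (q l) g) G"
    if "\<And>v. \<bar>g v\<bar> \<le> B" for l B and g :: "'e list \<Rightarrow> real"
    using lim[OF that] by (simp add: p_def)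
  have pmf_map: "pmf (map_pmf g r) w = measure_pmf.expectation r (\<lambda>v. indicator {w} (g v))" for g r and w :: "'e list"
  proof -
    have "(\<lambda>v. indicator {w} (g v) :: real) = indicator (g -` {w})" by (auto simp: indicator_def)
    then show ?thesis by (simp add: pmf_map)
  qed
  have "map_pmf (take l) (q (Suc l)) = q l" for l
  proof (rule pmf_eqI)
    fix w
    have "((\<lambda>N. measure_pmf.expectation (avg_history N) (\<lambda>h. indicator {w} (take l (take (Suc l) h)))) \<longlongrightarrow> pmf (map_pmf (take l) (q (Suc l))) w) G"
      unfolding pmf_map by (rule lim'[where B=1]) (auto simp: indicator_def)
    moreover have "((\<lambda>N. measure_pmf.expectation (avg_history N) (\<lambda>h. indicator {w} (take l h))) \<longlongrightarrow> pmf (map_pmf id (q l)) w) G"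
      unfolding pmf_map id_def by (rule lim'[where B=1]) (auto simp: indicator_def)
    ultimately show "pmf (map_pmf (take l) (q (Suc l))) w = pmf (q l) w"
      by (intro tendsto_unique[OF G(1)]) (simp_all add: min_def)
  qed
  moreover have "map_pmf tl (q (Suc l)) = q l" for l
  proof (rule pmf_eqI)
    fix w
    define g where "g = (\<lambda>h :: 'e list. indicator {w} (take l h) :: real)"
    \<comment> \<open>Forgetting the newest edge is a step back in time, so \<open>c (Suc k)\<close> is the expectation of \<open>g\<close> at time \<open>k\<close>.\<close>
    define c where "c k = measure_pmf.expectation (history k) (\<lambda>h. g (tl h))" for k
    have g1: "\<bar>g h\<bar> \<le> 1" for h by (auto simp: g_def indicator_def)
    have "\<bar>c k\<bar> \<le> 1" for k
      unfolding c_def by (rule order_trans[OF integral_abs_bound], rule measure_pmf.integral_le_const)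
        (use g1 in \<open>auto intro!: measure_pmf.integrable_const_bound[where B=1]\<close>)
    then have "(\<lambda>N. (\<Sum>k=N..2*N. c k) / (N + 1) - (\<Sum>k=N..2*N. c (Suc k)) / (N + 1)) \<longlonglongrightarrow> 0"
      by (rule averaged_shift_tendsto_0)
    moreover have "c (Suc k) = measure_pmf.expectation (history k) g" for k
    proof -
      have "c (Suc k) = measure_pmf.expectation (map_pmf (drop 1) (history (k + 1))) g"
        by (simp add: c_def drop_Suc del: history.simps)
      then show ?thesis by (simp only: map_drop_history)
    qed
    ultimately have "(\<lambda>N. measure_pmf.expectation (avg_history N) (\<lambda>h. g (tl h)) - measure_pmf.expectation (avg_history N) g) \<longlonglongrightarrow> 0"
      using g1 by (simp add: expectation_avg_history[where B=1] c_def)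
    then have "((\<lambda>N. measure_pmf.expectation (avg_history N) (\<lambda>h. g (tl h)) - measure_pmf.expectation (avg_history N) g) \<longlongrightarrow> 0) G"
      by (rule tendsto_mono[OF G(2)])
    moreover have "((\<lambda>N. measure_pmf.expectation (avg_history N) (\<lambda>h. indicator {w} (tl (take (Suc l) h)))) \<longlongrightarrow> pmf (map_pmf tl (q (Suc l))) w) G"
      unfolding pmf_map by (rule lim'[where B=1]) (auto simp: indicator_def)
    moreover have "((\<lambda>N. measure_pmf.expectation (avg_history N) (\<lambda>h. indicator {w} (take l h))) \<longlongrightarrow> pmf (map_pmf id (q l)) w) G"
      unfolding pmf_map id_def by (rule lim'[where B=1]) (auto simp: indicator_def)
    ultimately have "pmf (map_pmf tl (q (Suc l))) w - pmf (q l) w = 0"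
      by (intro tendsto_unique[OF G(1) tendsto_diff]) (simp_all add: g_def tl_take)
    then show "pmf (map_pmf tl (q (Suc l))) w = pmf (q l) w" by simp
  qed
  moreover have "length v = l" if "v \<in> set_pmf (q l)" for v l
    using that by (auto simp: set_pmf_iff q f_def split: if_splits)
  ultimately have "limit_words M x q G"
    by unfold_locales (use G in \<open>auto intro!: lim'\<close>)
  then show ?thesis by blast
qed

end

context limit_words
begin

lemma lim_pmf: "((\<lambda>N. measure_pmf.expectation (avg_history N) (\<lambda>h. indicator {w} (take l h))) \<longlongrightarrow> pmf (q l) w) G"
  using lim[of "indicator {w}" 1 l] by (auto simp: indicator_def measure_pmf_single)

text \<open>Admissibility is a condition on finite words that the chain never violates, so the limit does not either.\<close>

lemma q_support:
  assumes "v \<in> set_pmf (q l)"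
  shows "length v = l" "set v \<subseteq> edges M" "linked v"
proof -
  show "length v = l" using assms by (rule length_q)
  have "set v \<subseteq> edges M \<and> linked v"
  proof (rule ccontr)
    assume *: "\<not> (set v \<subseteq> edges M \<and> linked v)"
    have "h \<in> set_pmf (avg_history N) \<Longrightarrow> take l h \<noteq> v" for h N
      using avg_history_support[of h N] set_take_subset[of l h] linked_take[of h l] * by blast
    then have "measure_pmf.expectation (avg_history N) (\<lambda>h. indicator {v} (take l h)) = (0::real)" for N
      by (intro integral_eq_zero_AE) (auto simp: AE_measure_pmf_iff)
    then have "pmf (q l) v = 0"
      using tendsto_unique[OF G(1) lim_pmf] by (simp add: tendsto_const)
    with assms show False by (simp add: set_pmf_iff)
  qed
  then show "set v \<subseteq> edges M" "linked v" by auto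
qed

end

section \<open>The next edge under the limit law\<close>

locale contracting_limit = limit_words M x q G
  for M :: "('a::complete_space, 'e) markov_system" and x q G +
  fixes a C :: real
  assumes a: "0 < a" "a < 1" and C: "0 \<le> C"
    and gap: "\<And>l k. l \<le> k \<Longrightarrow> gap l k \<le> ennreal (C * a ^ l)"
    and uniform: "uniformly_continuous_system M"
begin

lemma abs_prb_le: "e \<in> edges M \<Longrightarrow> \<bar>prb M e y\<bar> \<le> 1"
  by (simp add: prb_nonneg prb_le_1)

text \<open>Both points lie in the same cell. Where they are \<open>\<delta>\<close>-close the weights differ by at most \<open>\<epsilon>\<close>;
elsewhere they differ by at most one, which is bounded by the distance divided by \<open>\<delta>\<close>.\<close>

lemma prb_recalled_close:
  assumes e: "e \<in> edges M" and "0 < \<delta>" "0 \<le> \<epsilon>" "l \<le> k"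
    and close: "\<And>y z. y \<in> cell M (ini M e) \<Longrightarrow> z \<in> cell M (ini M e) \<Longrightarrow> dist y z < \<delta> \<Longrightarrow> \<bar>prb M e y - prb M e z\<bar> \<le> \<epsilon>"
  shows "measure_pmf.expectation (history k) (\<lambda>h. \<bar>prb M e (position h) - prb M e (recalled l h)\<bar>) \<le> \<epsilon> + C * a ^ l / \<delta>"
proof (rule integral_real_bounded)
  show "0 \<le> \<epsilon> + C * a ^ l / \<delta>" using assms a C by simp
  have "(\<integral>\<^sup>+h. ennreal \<bar>prb M e (position h) - prb M e (recalled l h)\<bar> \<partial>measure_pmf (history k))
      \<le> (\<integral>\<^sup>+h. ennreal \<epsilon> + ennreal (1 / \<delta>) * ennreal (dist (position h) (recalled l h)) \<partial>measure_pmf (history k))"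
  proof (rule nn_integral_mono_AE, subst AE_measure_pmf_iff, intro ballI)
    fix h assume "h \<in> set_pmf (history k)"
    note h = history_support[OF this]
    have rc: "recalled l h \<in> cell M (vertex h)" using h assms by (intro recalled_cell) auto
    have "\<bar>prb M e (position h) - prb M e (recalled l h)\<bar> \<le> \<epsilon> + 1 / \<delta> * dist (position h) (recalled l h)"
    proof (cases "vertex h = ini M e")
      case True
      show ?thesis
      proof (cases "dist (position h) (recalled l h) < \<delta>")
        case True
        then have "\<bar>prb M e (position h) - prb M e (recalled l h)\<bar> \<le> \<epsilon>"
          using h rc \<open>vertex h = ini M e\<close> by (intro close) auto
        moreover have "0 \<le> 1 / \<delta> * dist (position h) (recalled l h)" using \<open>0 < \<delta>\<close> by simp
        ultimately show ?thesis by linarith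
      next
        case False
        then have "1 \<le> 1 / \<delta> * dist (position h) (recalled l h)" using \<open>0 < \<delta>\<close> by (simp add: field_simps)
        moreover have "\<bar>prb M e (position h) - prb M e (recalled l h)\<bar> \<le> 1"
          using prb_nonneg[OF e, of "position h"] prb_nonneg[OF e, of "recalled l h"]
            prb_le_1[OF e, of "position h"] prb_le_1[OF e, of "recalled l h"] by linarith
        ultimately show ?thesis using \<open>0 \<le> \<epsilon>\<close> by linarith
      qed
    next
      case False
      then have "prb M e (position h) = 0" "prb M e (recalled l h) = 0"
        using h rc e prb_off[of _ "vertex h" e] by auto
      then show ?thesis using \<open>0 \<le> \<epsilon>\<close> \<open>0 < \<delta>\<close> by simp
    qed
    then show "ennreal \<bar>prb M e (position h) - prb M e (recalled l h)\<bar> \<le> ennreal \<epsilon> + ennreal (1 / \<delta>) * ennreal (dist (position h) (recalled l h))"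
      using assms by (simp flip: ennreal_mult ennreal_plus)
  qed
  also have "\<dots> = ennreal \<epsilon> + ennreal (1 / \<delta>) * gap l k"
    by (simp add: gap_def nn_integral_add nn_integral_cmult)
  also have "\<dots> \<le> ennreal \<epsilon> + ennreal (1 / \<delta>) * ennreal (C * a ^ l)"
    by (intro add_mono mult_left_mono gap assms) auto
  also have "\<dots> = ennreal (\<epsilon> + C * a ^ l / \<delta>)"
    using assms a C by (simp flip: ennreal_mult ennreal_plus)
  finally show "(\<integral>\<^sup>+h. ennreal \<bar>prb M e (position h) - prb M e (recalled l h)\<bar> \<partial>measure_pmf (history k)) \<le> ennreal (\<epsilon> + C * a ^ l / \<delta>)" .
qed

text \<open>Both points approximate the current state, which is not a function of finitely many edges; it serves
only for the triangle inequality. The truncation at one gives a bounded test function.\<close>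

lemma backward_point_close:
  assumes "1 \<le> l"
  shows "measure_pmf.expectation (q (Suc l)) (\<lambda>v. min 1 (dist (backward_point v) (backward_point (take l v)))) \<le> 2 * C * a ^ l"
proof (rule tendsto_upperbound[OF lim[where B=1] _ G(1)])
  let ?f = "\<lambda>v. min 1 (dist (backward_point v) (backward_point (take l v)))"
  show "\<bar>?f v\<bar> \<le> 1" for v by (simp add: min_def)
  have "\<forall>\<^sub>F N in sequentially. measure_pmf.expectation (avg_history N) (\<lambda>h. ?f (take (Suc l) h)) \<le> 2 * C * a ^ l"
    using eventually_ge_at_top[of "Suc l"]
  proof eventually_elim
    case (elim N)
    show ?case
    proof (rule expectation_avg_history_le[where B=1])
      show "\<bar>?f (take (Suc l) h)\<bar> \<le> 1" for h by (simp add: min_def)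
      fix k assume "N \<le> k"
      with elim have k: "Suc l \<le> k" by simp
      show "measure_pmf.expectation (history k) (\<lambda>h. ?f (take (Suc l) h)) \<le> 2 * C * a ^ l"
      proof (rule integral_real_bounded)
        show "0 \<le> 2 * C * a ^ l" using a C by simp
        have "(\<integral>\<^sup>+h. ennreal (?f (take (Suc l) h)) \<partial>measure_pmf (history k))
            \<le> (\<integral>\<^sup>+h. ennreal (dist (position h) (recalled (Suc l) h)) + ennreal (dist (position h) (recalled l h)) \<partial>measure_pmf (history k))"
        proof (rule nn_integral_mono)
          fix h
          have "?f (take (Suc l) h) \<le> dist (recalled (Suc l) h) (recalled l h)"
            using assms by (simp add: recalled_def min_def)
          also have "\<dots> \<le> dist (position h) (recalled (Suc l) h) + dist (position h) (recalled l h)"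
            by (metis dist_commute dist_triangle)
          finally show "ennreal (?f (take (Suc l) h)) \<le> ennreal (dist (position h) (recalled (Suc l) h)) + ennreal (dist (position h) (recalled l h))"
            by (simp flip: ennreal_plus)
        qed
        also have "\<dots> = gap (Suc l) k + gap l k"
          by (simp add: gap_def nn_integral_add)
        also have "\<dots> \<le> ennreal (C * a ^ Suc l) + ennreal (C * a ^ l)"
          using k by (intro add_mono gap) auto
        also have "\<dots> = ennreal (C * a ^ Suc l + C * a ^ l)"
          using a C by (simp flip: ennreal_plus)
        also have "\<dots> \<le> ennreal (2 * C * a ^ l)"
        proof (rule ennreal_leI)
          have "C * a ^ Suc l \<le> C * a ^ l"
            using a C by (intro mult_left_mono power_decreasing) auto
          then show "C * a ^ Suc l + C * a ^ l \<le> 2 * C * a ^ l" by simp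
        qed
        finally show "(\<integral>\<^sup>+h. ennreal (?f (take (Suc l) h)) \<partial>measure_pmf (history k)) \<le> ennreal (2 * C * a ^ l)" .
      qed
    qed
  qed
  then show "\<forall>\<^sub>F N in G. measure_pmf.expectation (avg_history N) (\<lambda>h. ?f (take (Suc l) h)) \<le> 2 * C * a ^ l"
    by (rule filter_leD[OF G(2)])
qed

lemma history_next_edge:
  assumes e: "e \<in> edges M"
  shows "measure_pmf.expectation (history (Suc k)) (\<lambda>h. indicator {e # w} (take (Suc (length w)) h)) =
    measure_pmf.expectation (history k) (\<lambda>h. indicator {w} (take (length w) h) * prb M e (position h))"
proof -
  have int: "integrable (measure_pmf (history k)) (\<lambda>h. indicator {w} (take (length w) h) * prb M e (position h))"
    by (rule measure_pmf.integrable_const_bound[where B=1]) (use abs_prb_le[OF e] in \<open>auto simp: indicator_def\<close>)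
  have "emeasure (measure_pmf (history (Suc k))) {h. take (Suc (length w)) h = e # w}
      = (\<integral>\<^sup>+h. ennreal (indicator {w} (take (length w) h) * prb M e (position h)) \<partial>measure_pmf (history k))"
    unfolding emeasure_history_Suc
  proof (rule nn_integral_cong)
    fix h
    have "{e'. e' # h \<in> {h. take (Suc (length w)) h = e # w}} = (if take (length w) h = w then {e} else {})"
      by auto
    then show "emeasure (measure_pmf (step (position h))) {e'. e' # h \<in> {h. take (Suc (length w)) h = e # w}}
        = ennreal (indicator {w} (take (length w) h) * prb M e (position h))"
      using e by (simp add: emeasure_pmf_single pmf_step)
  qed
  also have "\<dots> = ennreal (measure_pmf.expectation (history k) (\<lambda>h. indicator {w} (take (length w) h) * prb M e (position h)))"
    by (rule nn_integral_eq_integral[OF int]) (simp add: prb_nonneg[OF e])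
  finally have "measure_pmf.prob (history (Suc k)) {h. take (Suc (length w)) h = e # w} =
      measure_pmf.expectation (history k) (\<lambda>h. indicator {w} (take (length w) h) * prb M e (position h))"
    by (simp add: measure_pmf.emeasure_eq_measure integral_nonneg_AE prb_nonneg[OF e] del: history.simps)
  moreover have "(\<lambda>h. indicator {e # w} (take (Suc (length w)) h) :: real) = indicator {h. take (Suc (length w)) h = e # w}"
    by (auto simp: indicator_def)
  ultimately show ?thesis by (simp del: history.simps)
qed

text \<open>A time step turns the probability of the word \<open>e # w\<close> into the mean of the weight of \<open>e\<close> over
histories ending in \<open>w\<close>, and time steps do not matter for the averages.\<close>

lemma avg_history_next_edge_tendsto:
  assumes e: "e \<in> edges M"
  shows "((\<lambda>N. measure_pmf.expectation (avg_history N) (\<lambda>h. indicator {w} (take (length w) h) * prb M e (position h)))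
    \<longlongrightarrow> pmf (q (Suc (length w))) (e # w)) G"
proof -
  let ?g = "\<lambda>h. indicator {e # w} (take (Suc (length w)) h) :: real"
  let ?f = "\<lambda>h. indicator {w} (take (length w) h) * prb M e (position h)"
  define c where "c k = measure_pmf.expectation (history k) ?g" for k
  have "\<bar>c k\<bar> \<le> 1" for k
    unfolding c_def by (rule order_trans[OF integral_abs_bound], rule measure_pmf.integral_le_const)
      (auto simp: indicator_def intro!: measure_pmf.integrable_const_bound[where B=1])
  then have "(\<lambda>N. (\<Sum>k=N..2*N. c k) / (N + 1) - (\<Sum>k=N..2*N. c (Suc k)) / (N + 1)) \<longlonglongrightarrow> 0"
    by (rule averaged_shift_tendsto_0)
  moreover have "measure_pmf.expectation (avg_history N) ?g = (\<Sum>k=N..2*N. c k) / (N + 1)" for N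
    unfolding c_def by (rule expectation_avg_history[where B=1]) (auto simp: indicator_def)
  moreover have "measure_pmf.expectation (avg_history N) ?f = (\<Sum>k=N..2*N. c (Suc k)) / (N + 1)" for N
    unfolding c_def history_next_edge[OF e]
    by (rule expectation_avg_history[where B=1]) (use abs_prb_le[OF e] in \<open>auto simp: indicator_def\<close>)
  ultimately have "(\<lambda>N. measure_pmf.expectation (avg_history N) ?g - measure_pmf.expectation (avg_history N) ?f) \<longlonglongrightarrow> 0"
    by simp
  then have "((\<lambda>N. measure_pmf.expectation (avg_history N) ?g - measure_pmf.expectation (avg_history N) ?f) \<longlongrightarrow> 0) G"
    by (rule tendsto_mono[OF G(2)])
  from tendsto_diff[OF lim_pmf[of "e # w" "Suc (length w)"] this] show ?thesis by simp
qed

text \<open>This is the conditional law of the next edge in the limit. The weight at the state of the chain is not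
a function of finitely many edges and has no meaning under \<open>q\<close>. Replacing the state by the point recalled
from \<open>l\<close> edges costs an error bounded uniformly in time, so the replacement survives the passage along \<open>G\<close>,
and the error vanishes as \<open>l\<close> tends to infinity.\<close>

lemma next_edge_limit:
  assumes e: "e \<in> edges M"
  shows "(\<lambda>l. measure_pmf.expectation (q l) (\<lambda>v. indicator {w} (take (length w) v) * prb M e (backward_point v)))
    \<longlonglongrightarrow> pmf (q (Suc (length w))) (e # w)"
proof (rule LIMSEQ_I)
  fix r :: real assume r: "0 < r"
  have "uniformly_continuous_on (cell M (ini M e)) (prb M e)"
    using uniform e by (simp add: uniformly_continuous_system_def)
  then obtain \<delta> where \<delta>: "\<delta> > 0" "\<And>y z. y \<in> cell M (ini M e) \<Longrightarrow> z \<in> cell M (ini M e) \<Longrightarrow> dist y z < \<delta> \<Longrightarrow> dist (prb M e y) (prb M e z) < r / 2"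
    using r unfolding uniformly_continuous_on_def by (metis dist_commute half_gt_zero)
  have "(\<lambda>l. C * a ^ l / \<delta>) \<longlonglongrightarrow> C * 0 / \<delta>"
    using a \<delta> by (intro tendsto_intros LIMSEQ_power_zero) auto
  then have "\<forall>\<^sub>F l in sequentially. C * a ^ l / \<delta> < r / 2"
    by (rule order_tendstoD) (use r in simp)
  then obtain l0 where l0: "\<And>l. l0 \<le> l \<Longrightarrow> C * a ^ l / \<delta> < r / 2"
    by (auto simp: eventually_sequentially)
  show "\<exists>no. \<forall>l\<ge>no. norm (measure_pmf.expectation (q l) (\<lambda>v. indicator {w} (take (length w) v) * prb M e (backward_point v)) - pmf (q (Suc (length w))) (e # w)) < r"
  proof (intro exI allI impI)
    fix l assume l: "max l0 (Suc (length w)) \<le> l"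
    let ?X = "\<lambda>N. measure_pmf.expectation (avg_history N) (\<lambda>h. indicator {w} (take (length w) h) * prb M e (position h))"
    let ?Y = "\<lambda>N. measure_pmf.expectation (avg_history N) (\<lambda>h. indicator {w} (take (length w) (take l h)) * prb M e (backward_point (take l h)))"
    have Y: "(?Y \<longlongrightarrow> measure_pmf.expectation (q l) (\<lambda>v. indicator {w} (take (length w) v) * prb M e (backward_point v))) G"
      by (rule lim[where B=1]) (use abs_prb_le[OF e] in \<open>auto simp: indicator_def\<close>)
    have "\<forall>\<^sub>F N in sequentially. \<bar>?Y N - ?X N\<bar> \<le> r / 2 + C * a ^ l / \<delta>"
      using eventually_ge_at_top[of l]
    proof eventually_elim
      case (elim N)
      have "?Y N - ?X N = measure_pmf.expectation (avg_history N) (\<lambda>h. indicator {w} (take (length w) (take l h)) * prb M e (backward_point (take l h)) - indicator {w} (take (length w) h) * prb M e (position h))"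
        by (subst Bochner_Integration.integral_diff)
           (use abs_prb_le[OF e] in \<open>auto simp: indicator_def intro!: measure_pmf.integrable_const_bound[where B=1]\<close>)
      also have "\<bar>\<dots>\<bar> \<le> measure_pmf.expectation (avg_history N) (\<lambda>h. \<bar>indicator {w} (take (length w) (take l h)) * prb M e (backward_point (take l h)) - indicator {w} (take (length w) h) * prb M e (position h)\<bar>)"
        by (rule integral_abs_bound)
      also have "\<dots> \<le> measure_pmf.expectation (avg_history N) (\<lambda>h. \<bar>prb M e (position h) - prb M e (recalled l h)\<bar>)"
      proof (rule integral_mono)
        have b: "\<bar>u * prb M e y - u' * prb M e z\<bar> \<le> 2" if "u \<in> {0,1}" "u' \<in> {0,1}" for u u' y z
          using abs_prb_le[OF e, of y] abs_prb_le[OF e, of z] that by auto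
        show "integrable (measure_pmf (avg_history N)) (\<lambda>h. \<bar>indicator {w} (take (length w) (take l h)) * prb M e (backward_point (take l h)) - indicator {w} (take (length w) h) * prb M e (position h)\<bar>)"
          by (rule measure_pmf.integrable_const_bound[where B=2], rule AE_I2,
              unfold real_norm_def abs_idempotent, rule b) (auto simp: indicator_def)
        show "integrable (measure_pmf (avg_history N)) (\<lambda>h. \<bar>prb M e (position h) - prb M e (recalled l h)\<bar>)"
          by (rule measure_pmf.integrable_const_bound[where B=2]) (use b[of 1 1] in auto)
        fix h
        have "take (length w) (take l h) = take (length w) h" "recalled l h = backward_point (take l h)"
          using l by (auto simp: recalled_def min_def)
        then show "\<bar>indicator {w} (take (length w) (take l h)) * prb M e (backward_point (take l h)) - indicator {w} (take (length w) h) * prb M e (position h)\<bar> \<le> \<bar>prb M e (position h) - prb M e (recalled l h)\<bar>"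
          by (auto simp: indicator_def)
      qed
      also have "\<dots> \<le> r / 2 + C * a ^ l / \<delta>"
      proof (rule expectation_avg_history_le[where B=1])
        show "\<bar>\<bar>prb M e (position h) - prb M e (recalled l h)\<bar>\<bar> \<le> 1" for h
          using prb_nonneg[OF e, of "position h"] prb_nonneg[OF e, of "recalled l h"]
            prb_le_1[OF e, of "position h"] prb_le_1[OF e, of "recalled l h"] by linarith
        fix k assume "N \<le> k"
        with elim show "measure_pmf.expectation (history k) (\<lambda>h. \<bar>prb M e (position h) - prb M e (recalled l h)\<bar>) \<le> r / 2 + C * a ^ l / \<delta>"
          using \<delta> r by (intro prb_recalled_close e) (auto simp: dist_real_def intro: less_imp_le)
      qed
      finally show ?case .
    qed
    then have bound: "\<forall>\<^sub>F N in G. \<bar>?Y N - ?X N\<bar> \<le> r / 2 + C * a ^ l / \<delta>"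
      by (rule filter_leD[OF G(2)])
    have "C * a ^ l / \<delta> < r / 2" using l0 l by simp
    with tendsto_upperbound[OF tendsto_rabs[OF tendsto_diff[OF Y avg_history_next_edge_tendsto[OF e]]] bound G(1)]
    show "norm (measure_pmf.expectation (q l) (\<lambda>v. indicator {w} (take (length w) v) * prb M e (backward_point v)) - pmf (q (Suc (length w))) (e # w)) < r"
      unfolding real_norm_def by linarith
  qed
qed

end

section \<open>Measurability on the code space\<close>

lemma measurable_count_space_countable_range:
  assumes "f \<in> space N \<rightarrow> R" "countable R" "\<And>v. v \<in> R \<Longrightarrow> f -` {v} \<inter> space N \<in> sets N"
  shows "f \<in> measurable N (count_space UNIV)"
proof (rule measurableI)
  fix A
  have "f -` A \<inter> space N = (\<Union>v\<in>A \<inter> R. f -` {v} \<inter> space N)" using assms(1) by auto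
  also have "\<dots> \<in> sets N" using assms by (intro sets.countable_UN'') auto
  finally show "f -` A \<inter> space N \<in> sets N" .
qed simp

lemma summable_min_dist_imp_convergent:
  fixes y :: "nat \<Rightarrow> 'b::complete_space"
  assumes "summable (\<lambda>n. min 1 (dist (y n) (y (Suc n))))"
  shows "convergent y"
proof -
  have "(\<lambda>n. min 1 (dist (y n) (y (Suc n)))) \<longlonglongrightarrow> 0"
    by (rule summable_LIMSEQ_zero[OF assms])
  then have "\<forall>\<^sub>F n in sequentially. min 1 (dist (y n) (y (Suc n))) < 1"
    by (rule order_tendstoD) simp
  then have "\<forall>\<^sub>F n in sequentially. dist (y n) (y (Suc n)) = min 1 (dist (y n) (y (Suc n)))"
    by eventually_elim (simp add: min_def split: if_splits)
  then have sum: "summable (\<lambda>n. dist (y n) (y (Suc n)))"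
    using assms summable_cong by fast
  have tri: "m \<le> n \<Longrightarrow> dist (y m) (y n) \<le> sum (\<lambda>n. dist (y n) (y (Suc n))) {m..<n}" for m n
  proof (induction n rule: dec_induct)
    case (step n)
    have "dist (y m) (y (Suc n)) \<le> dist (y m) (y n) + dist (y n) (y (Suc n))" by (rule dist_triangle)
    with step show ?case by simp
  qed simp
  have "Cauchy y"
    unfolding Cauchy_altdef
  proof (intro allI impI)
    fix e :: real assume "e > 0"
    then obtain K where K: "\<And>m n. K \<le> m \<Longrightarrow> norm (sum (\<lambda>n. dist (y n) (y (Suc n))) {m..<n}) < e"
      using sum unfolding summable_Cauchy by blast
    have "dist (y m) (y n) < e" if "K \<le> m" "m < n" for m n
      using tri[of m n] K[OF that(1), of n] that(2) by simp
    then show "\<exists>K. \<forall>m\<ge>K. \<forall>n>m. dist (y m) (y n) < e" by blast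
  qed
  then show ?thesis by (simp add: Cauchy_convergent_iff)
qed

lemma space_borel_of [simp]: "space (borel_of X) = topspace X"
  by (simp add: borel_of_def space_measure_of_conv)

lemma openin_sets_borel_of: "openin X U \<Longrightarrow> U \<in> sets (borel_of X)"
  unfolding borel_of_def by (subst sets_measure_of) (auto dest: openin_subset)

lemma closedin_sets_borel_of: "closedin X U \<Longrightarrow> U \<in> sets (borel_of X)"
proof -
  assume U: "closedin X U"
  then have "topspace X - (topspace X - U) \<in> sets (borel_of X)"
    using sets.compl_sets[OF openin_sets_borel_of[of X "topspace X - U"]] by (simp add: closedin_def)
  also have "topspace X - (topspace X - U) = U" using closedin_subset[OF U] by auto
  finally show ?thesis .
qed

lemma measurable_borel_ofI:
  assumes "f \<in> space N \<rightarrow> topspace X" "\<And>U. openin X U \<Longrightarrow> f -` U \<inter> space N \<in> sets N"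
  shows "f \<in> measurable N (borel_of X)"
  unfolding borel_of_def by (rule measurable_measure_of) (use assms in \<open>auto dest: openin_subset\<close>)

lemma measurable_borel_of_continuous_map:
  assumes "continuous_map X Y f"
  shows "f \<in> measurable (borel_of X) (borel_of Y)"
proof (rule measurable_borel_ofI)
  show "f \<in> space (borel_of X) \<rightarrow> topspace Y"
    using continuous_map_image_subset_topspace[OF assms] by auto
  fix U assume "openin Y U"
  then have "openin X {z \<in> topspace X. f z \<in> U}" using assms by (simp add: continuous_map)
  moreover have "{z \<in> topspace X. f z \<in> U} = f -` U \<inter> space (borel_of X)" by auto
  ultimately show "f -` U \<inter> space (borel_of X) \<in> sets (borel_of X)"
    by (metis openin_sets_borel_of)
qed

lemma window_0 [simp]: "window n 0 f = []"
  by (simp add: window_def)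

lemma window_Suc: "window n (Suc l) f = f n # window (n - 1) l f"
  by (simp add: window_def map_upt_Suc algebra_simps del: upt_Suc)

lemma take_window: "k \<le> l \<Longrightarrow> take k (window n l f) = window n k f"
  by (simp add: window_def take_map)

context coded_system
begin

lemma topspace_alphabet: "topspace (alphabet M) = insert None (Some ` edges M)"
  by (simp add: alphabet_def)

lemma topspace_code: "\<sigma> \<in> topspace (code_space M) \<longleftrightarrow> (\<forall>k. \<sigma> k \<in> insert None (Some ` edges M))"
  by (auto simp: code_space_def topspace_alphabet PiE_UNIV_domain Pi_def)

text \<open>The singletons of edges are open and the point at infinity is closed; so every singleton is Borel.\<close>

lemma singleton_letter:
  assumes "s \<in> topspace (alphabet M)"
  shows "openin (alphabet M) {s} \<or> closedin (alphabet M) {s}"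
proof (cases s)
  case None
  have "openin (alphabet M) (Some ` edges M)" by (simp add: alphabet_def)
  moreover have "topspace (alphabet M) - {None} = Some ` edges M" by (auto simp: topspace_alphabet)
  ultimately show ?thesis using None by (simp add: closedin_def topspace_alphabet)
next
  case (Some e)
  then have "openin (alphabet M) (Some ` {e})"
    using assms unfolding alphabet_def openin_Alexandroff_compactification_image_Some by auto
  then show ?thesis using Some by simp
qed

lemma continuous_map_coordinate: "continuous_map (code_space M) (alphabet M) (\<lambda>\<sigma>. \<sigma> k)"
  unfolding code_space_def by (rule continuous_map_product_projection) simp

lemma coordinate_sets:
  assumes "s \<in> topspace (alphabet M)"
  shows "{\<sigma> \<in> topspace (code_space M). \<sigma> k = s} \<in> sets (borel_of (code_space M))"
  using singleton_letter[OF assms]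
proof
  assume "openin (alphabet M) {s}"
  then have "openin (code_space M) {\<sigma> \<in> topspace (code_space M). \<sigma> k \<in> {s}}"
    using continuous_map_coordinate[of k] by (simp only: continuous_map_def)
  then show ?thesis using openin_sets_borel_of by fastforce
next
  assume "closedin (alphabet M) {s}"
  then have "closedin (code_space M) {\<sigma> \<in> topspace (code_space M). \<sigma> k \<in> {s}}"
    using continuous_map_coordinate[of k] by (simp only: continuous_map_closedin)
  then show ?thesis using closedin_sets_borel_of by fastforce
qed

definition words :: "'e option list set" where
  "words = lists (insert None (Some ` edges M))"

lemma countable_words: "countable words"
  unfolding words_def by (intro countable_lists countable_insert countable_image countable_edges)

lemma window_words: "\<sigma> \<in> topspace (code_space M) \<Longrightarrow> window n l \<sigma> \<in> words"
  by (auto simp: window_def words_def topspace_code lists_eq_set)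

lemma window_eq_iff: "window n l \<sigma> = v \<longleftrightarrow> length v = l \<and> (\<forall>j<l. \<sigma> (n - int j) = v ! j)"
  by (auto simp: list_eq_iff_nth_eq)

lemma measurable_window_code:
  "window n l \<in> measurable (borel_of (code_space M)) (count_space UNIV)"
proof (rule measurable_count_space_countable_range[OF _ countable_words])
  show "window n l \<in> space (borel_of (code_space M)) \<rightarrow> words" by (auto intro: window_words)
  fix v assume v: "v \<in> words"
  show "window n l -` {v} \<inter> space (borel_of (code_space M)) \<in> sets (borel_of (code_space M))"
  proof (cases "length v = l")
    case True
    have "window n l -` {v} \<inter> space (borel_of (code_space M)) =
      {\<sigma> \<in> space (borel_of (code_space M)). \<forall>j\<in>{..<l}. \<sigma> (n - int j) = v ! j}"
      using True by (auto simp: window_eq_iff)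
    also have "\<dots> \<in> sets (borel_of (code_space M))"
    proof (rule sets.sets_Collect_finite_All)
      fix j assume "j \<in> {..<l}"
      then have "v ! j \<in> set v" using True by simp
      then have "v ! j \<in> topspace (alphabet M)" using v by (auto simp: words_def lists_eq_set topspace_alphabet)
      from coordinate_sets[OF this] show "{\<sigma> \<in> space (borel_of (code_space M)). \<sigma> (n - int j) = v ! j} \<in> sets (borel_of (code_space M))"
        by simp
    qed simp
    finally show ?thesis .
  next
    case False
    then have "window n l -` {v} \<inter> space (borel_of (code_space M)) = {}" by (auto simp: window_eq_iff)
    then show ?thesis by simp
  qed
qed

lemma cylinder_window:
  "m \<le> 0 \<Longrightarrow> cylinder M m 0 e = {\<sigma> \<in> topspace (code_space M). window 0 (Suc (nat (- m))) \<sigma> = window 0 (Suc (nat (- m))) e}"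
  unfolding cylinder_def
proof (intro Collect_cong conj_cong refl iffI ballI)
  fix \<sigma> k assume "m \<le> 0" "window 0 (Suc (nat (- m))) \<sigma> = window 0 (Suc (nat (- m))) e" "k \<in> {m..0}"
  then show "\<sigma> k = e k"
    unfolding window_eq_iff by (auto dest!: spec[of _ "nat (- k)"])
qed (auto simp: window_def)

lemma past_algebra_generator:
  "{cylinder M m 0 e | m e. m \<le> 0 \<and> (\<forall>k\<in>{m..0}. e k \<in> topspace (alphabet M))} \<subseteq> Pow (topspace (code_space M))"
  by (auto simp: cylinder_def)

lemma space_past_algebra [simp]: "space (past_algebra M) = topspace (code_space M)"
  by (simp add: past_algebra_def space_measure_of_conv)

text \<open>Words that end at time \<open>0\<close> are exactly the data recorded by the generators of the past algebra.\<close>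

lemma measurable_past_window:
  "window 0 l \<in> measurable (past_algebra M) (count_space UNIV)"
proof (rule measurable_count_space_countable_range[OF _ countable_words])
  show "window 0 l \<in> space (past_algebra M) \<rightarrow> words" by (auto intro: window_words)
  fix v assume v: "v \<in> words"
  consider "l = 0" "v = []" | "length v \<noteq> l" | l' where "l = Suc l'" "length v = l" by (cases l) auto
  then show "window 0 l -` {v} \<inter> space (past_algebra M) \<in> sets (past_algebra M)"
  proof cases
    case 1
    then have "window 0 l -` {v} \<inter> space (past_algebra M) = space (past_algebra M)" by (auto simp: window_def)
    then show ?thesis by (simp only: sets.top)
  next
    case 2
    then have "window 0 l -` {v} \<inter> space (past_algebra M) = {}" by (auto simp: window_eq_iff)
    then show ?thesis by simp
  next
    case 3
    define e where "e k = v ! nat (- k)" for k :: int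
    have "window 0 l e = v" using 3 by (auto simp: window_eq_iff e_def)
    then have "window 0 l -` {v} \<inter> space (past_algebra M) = cylinder M (- int l') 0 e"
      using 3(1) by (auto simp: cylinder_window)
    moreover have "e k \<in> topspace (alphabet M)" if "k \<in> {- int l'..0}" for k
    proof -
      have "e k \<in> set v" using that 3 by (auto simp: e_def intro!: nth_mem)
      then show ?thesis using v by (auto simp: words_def lists_eq_set topspace_alphabet)
    qed
    ultimately show ?thesis
      unfolding past_algebra_def using past_algebra_generator
      by (subst sets_measure_of) (auto intro!: sigma_sets.Basic exI[of _ "- int l'"] exI[of _ e])
  qed
qed

lemma sets_past_algebra_subset: "sets (past_algebra M) \<subseteq> sets (borel_of (code_space M))"
  unfolding past_algebra_def
proof (rule sets.sigma_sets_subset[of _ "borel_of (code_space M)", simplified space_borel_of, THEN subset_trans[rotated]])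
  show "sets (sigma (topspace (code_space M)) {cylinder M m 0 e | m e. m \<le> 0 \<and> (\<forall>k\<in>{m..0}. e k \<in> topspace (alphabet M))})
    \<subseteq> sigma_sets (topspace (code_space M)) {cylinder M m 0 e | m e. m \<le> 0 \<and> (\<forall>k\<in>{m..0}. e k \<in> topspace (alphabet M))}"
    using past_algebra_generator by (subst sets_measure_of) auto
  show "{cylinder M m 0 e | m e. m \<le> 0 \<and> (\<forall>k\<in>{m..0}. e k \<in> topspace (alphabet M))} \<subseteq> sets (borel_of (code_space M))"
  proof (safe, unfold cylinder_window)
    fix m :: int and e :: "int \<Rightarrow> 'e option"
    show "{\<sigma> \<in> topspace (code_space M). window 0 (Suc (nat (- m))) \<sigma> = window 0 (Suc (nat (- m))) e} \<in> sets (borel_of (code_space M))"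
      using measurable_sets[OF measurable_window_code[of 0 "Suc (nat (- m))"], of "{window 0 (Suc (nat (- m))) e}"]
      by (simp add: vimage_def Int_def conj_commute)
  qed
qed

lemma back_comp_eq: "back_comp M \<sigma> n z = foldr (wmap_ext M) (window 0 (Suc n) \<sigma>) z"
proof (induction n arbitrary: z)
  case (Suc n)
  have "window 0 (Suc (Suc n)) \<sigma> = window 0 (Suc n) \<sigma> @ [\<sigma> (- int (Suc n))]"
    by (simp add: window_def)
  with Suc show ?case by simp
qed (simp add: window_def)

lemma back_orbit_eq:
  assumes "\<sigma> \<in> path_space M"
  shows "back_orbit M x \<sigma> n = backward_point (map the (window 0 (Suc n) \<sigma>))"
proof -
  have some: "\<sigma> k = Some (the (\<sigma> k))" for k
  proof -
    have "\<sigma> k \<in> Some ` edges M" using assms unfolding path_space_def by blast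
    then show ?thesis by auto
  qed
  have "foldr (wmap_ext M) v z = foldr (wmap M) (map the v) z" if "\<forall>s\<in>set v. s \<noteq> None" for v z
    using that by (induction v) auto
  moreover have "\<forall>s\<in>set (window 0 (Suc n) \<sigma>). s \<noteq> None"
    using some by (auto simp: window_def)
  moreover have "ini_ext M (\<sigma> (- int n)) = ini M (the (\<sigma> (- int n)))"
    by (subst some) simp
  moreover have "last (map the (window 0 (Suc n) \<sigma>)) = the (\<sigma> (- int n))"
    by (simp add: window_def)
  ultimately show ?thesis by (simp add: back_orbit_def back_comp_eq backward_point_def)
qed

lemma path_window:
  assumes "\<sigma> \<in> path_space M"
  shows "linked (map the (window n l \<sigma>))" "set (map the (window n l \<sigma>)) \<subseteq> edges M"
proof -
  have some: "\<sigma> k \<in> Some ` edges M" "ini_ext M (\<sigma> (k + 1)) = ter_ext M (\<sigma> k)" for k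
    using assms by (auto simp: path_space_def)
  have link: "ini M (the (\<sigma> k)) = ter M (the (\<sigma> (k - 1)))" for k
    using some(1)[of k] some(1)[of "k - 1"] some(2)[of "k - 1"] by auto
  show "set (map the (window n l \<sigma>)) \<subseteq> edges M"
  proof -
    have "the (\<sigma> k) \<in> edges M" for k using some(1)[of k] by auto
    then show ?thesis by (auto simp: window_def)
  qed
  show "linked (map the (window n l \<sigma>))"
  proof (induction l arbitrary: n)
    case (Suc l)
    have "hd (map the (window (n - 1) l \<sigma>)) = the (\<sigma> (n - 1))" if "window (n - 1) l \<sigma> \<noteq> []"
      using that by (cases l) (simp_all add: window_Suc window_0)
    with Suc[of "n - 1"] show ?case by (auto simp: window_Suc link)
  qed (simp add: window_0)
qed

lemma backward_point_cell: "v \<noteq> [] \<Longrightarrow> linked v \<Longrightarrow> set v \<subseteq> edges M \<Longrightarrow> backward_point v \<in> cell M (ter M (hd v))"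
  using recalled_cell[of v "length v"] by (simp add: recalled_def vertex_eq)

text \<open>A uniformly continuous function has exactly one continuous extension to the closure of its
domain, so the definite description denotes it.\<close>

lemma prb_closure_props:
  assumes "uniformly_continuous_system M" "e \<in> edges M"
  shows "continuous_on (closure (cell M (ini M e))) (prb_closure M e)"
    "\<And>z. z \<in> cell M (ini M e) \<Longrightarrow> prb_closure M e z = prb M e z"
proof -
  let ?S = "cell M (ini M e)"
  have "uniformly_continuous_on ?S (prb M e)"
    using assms by (simp add: uniformly_continuous_system_def)
  then obtain g where g: "uniformly_continuous_on (closure ?S) g" "\<And>z. z \<in> ?S \<Longrightarrow> prb M e z = g z"
    and uniq: "\<And>Y h z. ?S \<subseteq> Y \<Longrightarrow> Y \<subseteq> closure ?S \<Longrightarrow> continuous_on Y h \<Longrightarrow> (\<And>z. z \<in> ?S \<Longrightarrow> prb M e z = h z) \<Longrightarrow> z \<in> Y \<Longrightarrow> h z = g z"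
    by (rule uniformly_continuous_on_extension_on_closure) blast
  let ?P = "\<lambda>g. continuous_on (closure ?S) g \<and> (\<forall>z\<in>?S. g z = prb M e z) \<and> (\<forall>z. z \<notin> closure ?S \<longrightarrow> g z = 0)"
  have "\<exists>!g. ?P g"
  proof (rule ex1I)
    let ?g = "\<lambda>z. if z \<in> closure ?S then g z else 0"
    show "?P ?g"
      using uniformly_continuous_imp_continuous[OF g(1)] g(2) closure_subset[of ?S]
      by (auto cong: continuous_on_cong)
    fix h assume "?P h"
    then have "h z = g z" if "z \<in> closure ?S" for z
      using that uniq[of "closure ?S" h z] closure_subset by auto
    with \<open>?P h\<close> show "h = ?g" by auto
  qed
  from theI'[OF this] show "continuous_on (closure ?S) (prb_closure M e)"
    "\<And>z. z \<in> ?S \<Longrightarrow> prb_closure M e z = prb M e z"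
    unfolding prb_closure_def by auto
qed

text \<open>If the path ends at the initial vertex of \<open>e\<close>, its backward orbit stays in the cell on which the
weight is uniformly continuous, and the limit lies in the closure of that cell. Otherwise the orbit
stays in a cell where the weight vanishes, and the indicator is zero.\<close>

lemma prb_backward_point_tendsto:
  assumes "uniformly_continuous_system M" "e \<in> edges M" "\<sigma> \<in> coding_dom M x"
  shows "(\<lambda>l. prb M e (backward_point (map the (window 0 (Suc l) \<sigma>)))) \<longlonglongrightarrow>
    prb_closure M e (coding_map M x \<sigma>) * indicator (paths_ending M (ini M e)) \<sigma>"
proof -
  have path: "\<sigma> \<in> path_space M" and conv: "convergent (back_orbit M x \<sigma>)"
    using assms(3) by (auto simp: coding_dom_def)
  obtain e0 where e0: "\<sigma> 0 = Some e0" "e0 \<in> edges M" using path by (auto simp: path_space_def)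
  let ?y = "\<lambda>l. backward_point (map the (window 0 (Suc l) \<sigma>))"
  have cell: "?y l \<in> cell M (ter M e0)" for l
    using backward_point_cell[OF _ path_window[OF path, where n=0 and l="Suc l"]] e0 by (simp add: window_Suc)
  have lim: "?y \<longlonglongrightarrow> coding_map M x \<sigma>"
    using conv assms(3) by (simp add: coding_map_def convergent_LIMSEQ_iff back_orbit_eq[OF path, abs_def])
  show ?thesis
  proof (cases "ter M e0 = ini M e")
    case True
    have "coding_map M x \<sigma> \<in> closure (cell M (ini M e))"
      unfolding closure_sequential using lim cell True by (intro exI[of _ ?y]) auto
    moreover have "?y l \<in> closure (cell M (ini M e))" for l
      using cell[of l] True closure_subset by auto
    ultimately have "(\<lambda>l. prb_closure M e (?y l)) \<longlonglongrightarrow> prb_closure M e (coding_map M x \<sigma>)"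
      using prb_closure_props(1)[OF assms(1,2)] lim by (auto simp: continuous_on_sequentially o_def)
    moreover have "prb_closure M e (?y l) = prb M e (?y l)" for l
      using cell[of l] True by (intro prb_closure_props(2)[OF assms(1,2)]) simp
    moreover have "\<sigma> \<in> paths_ending M (ini M e)" using path e0 True by (simp add: paths_ending_def)
    ultimately show ?thesis by simp
  next
    case False
    then have "prb M e (?y l) = 0" for l
      using prb_off[OF cell ter_vert[OF e0(2)] assms(2)] by auto
    moreover have "\<sigma> \<notin> paths_ending M (ini M e)" using e0 False by (simp add: paths_ending_def)
    ultimately show ?thesis by simp
  qed
qed

text \<open>By completeness, convergence of the backward orbit is the Cauchy condition, which involves countably
many functions of finite words.\<close>

lemma coding_dom_sets: "coding_dom M x \<in> sets (borel_of (code_space M))"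
proof -
  let ?B = "borel_of (code_space M)"
  have pred: "Measurable.pred ?B (\<lambda>\<sigma>. Q (window n l \<sigma>))" for Q n l
    by (rule measurable_compose[OF measurable_window_code]) simp
  have "coding_dom M x = {\<sigma> \<in> space ?B.
      (\<forall>n. \<sigma> n \<in> Some ` edges M \<and> ini_ext M (\<sigma> (n + 1)) = ter_ext M (\<sigma> n)) \<and>
      Cauchy (\<lambda>l. backward_point (map the (window 0 (Suc l) \<sigma>)))}"
  proof -
    have "back_orbit M x \<sigma> = (\<lambda>l. backward_point (map the (window 0 (Suc l) \<sigma>)))" if "\<sigma> \<in> path_space M" for \<sigma>
      by (rule ext) (rule back_orbit_eq[OF that])
    then have "coding_dom M x = {\<sigma> \<in> path_space M. Cauchy (\<lambda>l. backward_point (map the (window 0 (Suc l) \<sigma>)))}"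
      by (auto simp: coding_dom_def Cauchy_convergent_iff)
    then show ?thesis by (simp add: path_space_def conj_assoc)
  qed
  also have "\<dots> = {\<sigma> \<in> space ?B.
      (\<forall>n. window (n + 1) 2 \<sigma> ! 1 \<in> Some ` edges M \<and> ini_ext M (window (n + 1) 2 \<sigma> ! 0) = ter_ext M (window (n + 1) 2 \<sigma> ! 1)) \<and>
      (\<forall>j. \<exists>K. \<forall>m\<ge>K. \<forall>n\<ge>K. dist (backward_point (map the (take (Suc m) (window 0 (Suc (max m n)) \<sigma>)))) (backward_point (map the (take (Suc n) (window 0 (Suc (max m n)) \<sigma>)))) < inverse (real (Suc j)))}"
    by (simp add: metric_Cauchy_iff2 take_window)
  also have "\<dots> \<in> sets ?B"
    by (rule predE) (intro pred_intros_logic pred_intros_countable pred)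
  finally show ?thesis .
qed

end

section \<open>The limit law on the code space\<close>

text \<open>Edges are numbered, the sequence of numbers is extended to a two-sided stationary one, and the
numbers are decoded. Decoding is continuous, so Borel sets of the code space pull back to the product
$\sigma$-algebra.\<close>

lemma (in limit_words) code_law_exists:
  "\<exists>\<Lambda>\<in>shift_invariant_probs M. \<forall>n l. distr \<Lambda> (count_space UNIV) (window n l) = measure_pmf (map_pmf (map Some) (q l))"
proof -
  let ?enc = "to_nat_on (edges M)" and ?dec = "from_nat_into (edges M)"
  let ?seq = "PiM UNIV (\<lambda>_. count_space UNIV) :: (int \<Rightarrow> nat) measure"
  let ?B = "borel_of (code_space M)"
  obtain P :: "(int \<Rightarrow> nat) measure" where P: "prob_space P" "sets P = sets ?seq"
    and law: "\<And>n l. distr P (count_space UNIV) (window n l) = measure_pmf (map_pmf (map ?enc) (q l))"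
    by (rule two_sided_extension[of ?enc]) blast
  interpret P: prob_space P by fact
  have spaceP: "space P = UNIV" using sets_eq_imp_space_eq[OF P(2)] by (simp add: space_PiM)
  have setsP: "sets P = sets borel"
  proof -
    have "sets ?seq = sets (PiM UNIV (\<lambda>_. borel))"
      by (intro sets_PiM_cong) (simp_all add: sets_borel_eq_count_space)
    then show ?thesis using P(2) sets_PiM_equal_borel by metis
  qed
  have win [measurable]: "window n l \<in> measurable P (count_space UNIV)" for n l
    by (simp add: measurable_cong_sets[OF P(2) refl])
  define \<phi> where "\<phi> f = (\<lambda>i. Some (?dec (f i)))" for f :: "int \<Rightarrow> nat"
  have dec: "?dec k \<in> edges M" for k by (rule from_nat_into[OF edges_ne])
  have "continuous_map euclidean (code_space M) \<phi>"
    unfolding code_space_def continuous_map_componentwise_UNIV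
  proof
    fix k
    have "continuous_map euclidean (alphabet M) (\<lambda>j::nat. Some (?dec j))"
      by (simp add: continuous_map_def topspace_alphabet dec Topological_Spaces.open_discrete)
    moreover have "continuous_map euclidean euclidean (\<lambda>f :: int \<Rightarrow> nat. f k)"
      using continuous_on_product_coordinates by simp
    ultimately have "continuous_map euclidean (alphabet M) ((\<lambda>j. Some (?dec j)) \<circ> (\<lambda>f :: int \<Rightarrow> nat. f k))"
      by (rule continuous_map_compose[rotated])
    then show "continuous_map euclidean (alphabet M) (\<lambda>f. \<phi> f k)" by (simp add: o_def \<phi>_def)
  qed
  then have \<phi>: "\<phi> \<in> measurable P ?B"
    by (intro measurable_borel_ofI) (auto simp: spaceP setsP continuous_map_def vimage_def topspace_code \<phi>_def dec)
  have shift: "shift \<in> measurable ?B ?B"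
    by (rule measurable_borel_of_continuous_map)
      (use continuous_map_coordinate in \<open>simp add: code_space_def continuous_map_componentwise_UNIV shift_def\<close>)
  have shift': "(\<lambda>f k. f (k + 1)) \<in> measurable P ?seq"
    unfolding measurable_cong_sets[OF P(2) refl] by (rule measurable_PiM_single') (auto simp: space_PiM)
  have "distr P ?seq (\<lambda>f k. f (k + 1)) = P"
  proof (rule window_laws_determine[OF P.prob_space_distr[OF shift'] _ P(2)])
    fix n l
    have "distr (distr P ?seq (\<lambda>f k. f (k + 1))) (count_space UNIV) (window n l) = distr P (count_space UNIV) (window (n + 1) l)"
      by (subst distr_distr[OF measurable_window shift']) (auto simp: window_def o_def algebra_simps intro!: distr_cong)
    then show "distr (distr P ?seq (\<lambda>f k. f (k + 1))) (count_space UNIV) (window n l) = distr P (count_space UNIV) (window n l)"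
      by (simp add: law)
  qed simp
  then have "distr (distr P ?seq (\<lambda>f k. f (k + 1))) ?B \<phi> = distr P ?B \<phi>" by simp
  moreover have "\<phi> \<in> measurable ?seq ?B" using \<phi> by (simp add: measurable_cong_sets[OF P(2) refl])
  ultimately have inv: "distr P ?B (\<lambda>f. \<phi> (\<lambda>k. f (k + 1))) = distr P ?B \<phi>"
    using distr_distr[OF _ shift', of \<phi> ?B] by (simp add: o_def)
  have "distr (distr P ?B \<phi>) ?B shift = distr P ?B \<phi>"
    by (subst distr_distr[OF shift \<phi>]) (use inv in \<open>simp add: o_def shift_def \<phi>_def\<close>)
  then have "distr P ?B \<phi> \<in> shift_invariant_probs M"
    by (simp add: shift_invariant_probs_def P.prob_space_distr[OF \<phi>])
  moreover have "distr (distr P ?B \<phi>) (count_space UNIV) (window n l) = measure_pmf (map_pmf (map Some) (q l))" for n l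
  proof -
    have "distr (distr P ?B \<phi>) (count_space UNIV) (window n l) = distr P (count_space UNIV) (\<lambda>f. map (\<lambda>j. Some (?dec j)) (window n l f))"
      by (subst distr_distr[OF measurable_window_code \<phi>]) (auto simp: window_def \<phi>_def o_def intro!: distr_cong)
    also have "\<dots> = distr (distr P (count_space UNIV) (window n l)) (count_space UNIV) (map (\<lambda>j. Some (?dec j)))"
      by (subst distr_distr) (auto simp: o_def)
    also have "\<dots> = measure_pmf (map_pmf (map (\<lambda>j. Some (?dec j))) (map_pmf (map ?enc) (q l)))"
      unfolding law by (simp add: map_pmf_rep_eq)
    also have "map_pmf (map (\<lambda>j. Some (?dec j))) (map_pmf (map ?enc) (q l)) = map_pmf (map Some) (q l)"
      unfolding pmf.map_comp o_def
    proof (rule map_pmf_cong[OF refl])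
      fix v assume "v \<in> set_pmf (q l)"
      then have "set v \<subseteq> edges M" by (rule q_support)
      then show "map (\<lambda>j. Some (?dec j)) (map ?enc v) = map Some v"
        by (auto simp: from_nat_into_to_nat_on[OF countable_edges])
    qed
    finally show ?thesis .
  qed
  ultimately show ?thesis by blast
qed

locale code_law = contracting_limit M x q G a C
  for M :: "('a::complete_space, 'e) markov_system" and x q G a C +
  fixes \<Lambda> :: "(int \<Rightarrow> 'e option) measure"
  assumes invariant: "\<Lambda> \<in> shift_invariant_probs M"
    and law: "\<And>n l. distr \<Lambda> (count_space UNIV) (window n l) = measure_pmf (map_pmf (map Some) (q l))"
begin

lemma prob_space_\<Lambda>: "prob_space \<Lambda>" and sets_\<Lambda>: "sets \<Lambda> = sets (borel_of (code_space M))"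
  using invariant by (auto simp: shift_invariant_probs_def)

sublocale L: prob_space \<Lambda>
  by (rule prob_space_\<Lambda>)

lemma space_\<Lambda>: "space \<Lambda> = topspace (code_space M)"
  using sets_eq_imp_space_eq[OF sets_\<Lambda>] by simp

lemma window_measurable [measurable]: "window n l \<in> measurable \<Lambda> (count_space UNIV)"
  using measurable_window_code by (simp add: measurable_cong_sets[OF sets_\<Lambda> refl])

lemma AE_window: "(AE \<sigma> in \<Lambda>. Q (window n l \<sigma>)) \<longleftrightarrow> (\<forall>v\<in>set_pmf (q l). Q (map Some v))"
proof -
  have "(AE \<sigma> in \<Lambda>. Q (window n l \<sigma>)) \<longleftrightarrow> (AE v in distr \<Lambda> (count_space UNIV) (window n l). Q v)"
    by (subst AE_distr_iff) auto
  then show ?thesis unfolding law AE_measure_pmf_iff by simp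
qed

lemma integral_window:
  fixes f :: "'e option list \<Rightarrow> real"
  shows "(\<integral>\<sigma>. f (window n l \<sigma>) \<partial>\<Lambda>) = measure_pmf.expectation (q l) (\<lambda>v. f (map Some v))"
proof -
  have "(\<integral>\<sigma>. f (window n l \<sigma>) \<partial>\<Lambda>) = (\<integral>v. f v \<partial>distr \<Lambda> (count_space UNIV) (window n l))"
    by (subst integral_distr) auto
  then show ?thesis by (simp add: law)
qed

lemma AE_path: "AE \<sigma> in \<Lambda>. \<sigma> \<in> path_space M"
proof -
  let ?Q = "\<lambda>v. v ! 1 \<in> Some ` edges M \<and> ini_ext M (v ! 0) = ter_ext M (v ! 1)"
  have "AE \<sigma> in \<Lambda>. ?Q (window (n + 1) 2 \<sigma>)" for n
  proof (rule AE_window[THEN iffD2], rule ballI)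
    fix v assume "v \<in> set_pmf (q 2)"
    note v = q_support[OF this]
    then obtain e1 e0 where "v = [e1, e0]" by (metis length_0_conv length_Suc_conv numeral_2_eq_2)
    with v show "?Q (map Some v)" by auto
  qed
  then have "AE \<sigma> in \<Lambda>. \<forall>n. ?Q (window (n + 1) 2 \<sigma>)"
    by (subst AE_all_countable) blast
  with AE_space show ?thesis
    by eventually_elim (auto simp: path_space_def space_\<Lambda>)
qed

text \<open>The expected increments of the backward orbit decay geometrically, so the increments are almost surely
summable.\<close>

lemma AE_coding_dom: "AE \<sigma> in \<Lambda>. \<sigma> \<in> coding_dom M x"
proof -
  let ?y = "\<lambda>\<sigma> l. backward_point (map the (window 0 (Suc l) \<sigma>))"
  let ?d = "\<lambda>l \<sigma>. min 1 (dist (?y \<sigma> l) (?y \<sigma> (Suc l)))"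
  define F where "F l v = min 1 (dist (backward_point (map the (take (Suc l) v))) (backward_point (map the v)))" for l and v :: "'e option list"
  have d_eq: "?d l = (\<lambda>\<sigma>. F l (window 0 (Suc (Suc l)) \<sigma>))" for l
    by (simp add: F_def take_window)
  have meas: "?d l \<in> borel_measurable \<Lambda>" for l
    unfolding d_eq by (rule measurable_compose[OF window_measurable]) simp
  have "(\<integral>\<^sup>+\<sigma>. ennreal (?d l \<sigma>) \<partial>\<Lambda>) \<le> ennreal (2 * C * a ^ Suc l)" for l
  proof -
    have "(\<integral>\<^sup>+\<sigma>. ennreal (?d l \<sigma>) \<partial>\<Lambda>) = ennreal (\<integral>\<sigma>. ?d l \<sigma> \<partial>\<Lambda>)"
      by (intro nn_integral_eq_integral L.integrable_const_bound[where B=1] meas) (auto simp: min_def)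
    also have "(\<integral>\<sigma>. ?d l \<sigma> \<partial>\<Lambda>) = measure_pmf.expectation (q (Suc (Suc l))) (\<lambda>v. min 1 (dist (backward_point v) (backward_point (take (Suc l) v))))"
      unfolding d_eq integral_window by (simp add: F_def take_map o_def dist_commute)
    also have "\<dots> \<le> 2 * C * a ^ Suc l" by (rule backward_point_close) simp
    finally show ?thesis by (simp add: ennreal_leI)
  qed
  then have "(\<Sum>l. \<integral>\<^sup>+\<sigma>. ennreal (?d l \<sigma>) \<partial>\<Lambda>) \<le> (\<Sum>l. ennreal (2 * C * a ^ Suc l))"
    by (intro suminf_le) auto
  also have "\<dots> < \<infinity>"
  proof -
    have "summable (\<lambda>l. 2 * C * a ^ Suc l)"
      using a by (intro summable_mult) (simp add: summable_geometric summable_Suc_iff del: power_Suc)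
    then show ?thesis using a C by (subst suminf_ennreal2) auto
  qed
  finally have "(\<integral>\<^sup>+\<sigma>. (\<Sum>l. ennreal (?d l \<sigma>)) \<partial>\<Lambda>) \<noteq> \<infinity>"
    using meas by (subst nn_integral_suminf) auto
  then have "AE \<sigma> in \<Lambda>. (\<Sum>l. ennreal (?d l \<sigma>)) \<noteq> \<infinity>"
    using meas by (intro nn_integral_PInf_AE) auto
  then show ?thesis using AE_path
  proof eventually_elim
    case (elim \<sigma>)
    have "summable (\<lambda>l. ?d l \<sigma>)"
      by (rule summable_suminf_not_top) (use elim in auto)
    then have "convergent (?y \<sigma>)" by (rule summable_min_dist_imp_convergent)
    moreover have "back_orbit M x \<sigma> = ?y \<sigma>" by (rule ext) (rule back_orbit_eq[OF elim(2)])
    ultimately show ?case using elim(2) by (simp add: coding_dom_def)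
  qed
qed

text \<open>This limit agrees almost surely with the prescribed conditional probability and depends on the past
only, whereas admissibility of a path, which the prescribed expression mentions, also concerns its future.\<close>

definition next_prob :: "'e \<Rightarrow> (int \<Rightarrow> 'e option) \<Rightarrow> real" where
  "next_prob e \<sigma> = lim (\<lambda>l. prb M e (backward_point (map the (window 0 (Suc l) \<sigma>))))"

lemma subalgebra_past: "subalgebra \<Lambda> (past_algebra M)"
  using sets_past_algebra_subset by (simp add: subalgebra_def space_\<Lambda> sets_\<Lambda>)

lemma next_prob_measurable: "next_prob e \<in> borel_measurable (past_algebra M)"
  unfolding next_prob_def
  by (intro borel_measurable_lim_metric measurable_compose[OF measurable_past_window]) simp

lemma next_prob_measurable_\<Lambda> [measurable]: "next_prob e \<in> borel_measurable \<Lambda>"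
  by (rule measurable_from_subalg[OF subalgebra_past next_prob_measurable])

lemma AE_tendsto_next_prob:
  assumes "e \<in> edges M"
  shows "AE \<sigma> in \<Lambda>. (\<lambda>l. prb M e (backward_point (map the (window 0 (Suc l) \<sigma>)))) \<longlonglongrightarrow> next_prob e \<sigma>"
    and "AE \<sigma> in \<Lambda>. next_prob e \<sigma> = prb_closure M e (coding_map M x \<sigma>) * indicator (paths_ending M (ini M e)) \<sigma>"
proof -
  show "AE \<sigma> in \<Lambda>. (\<lambda>l. prb M e (backward_point (map the (window 0 (Suc l) \<sigma>)))) \<longlonglongrightarrow> next_prob e \<sigma>"
    using AE_coding_dom
  proof eventually_elim
    case (elim \<sigma>)
    from prb_backward_point_tendsto[OF uniform assms elim] show ?case
      unfolding next_prob_def by (simp add: limI)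
  qed
  show "AE \<sigma> in \<Lambda>. next_prob e \<sigma> = prb_closure M e (coding_map M x \<sigma>) * indicator (paths_ending M (ini M e)) \<sigma>"
    using AE_coding_dom
  proof eventually_elim
    case (elim \<sigma>)
    from prb_backward_point_tendsto[OF uniform assms elim] show ?case
      unfolding next_prob_def by (rule limI)
  qed
qed

lemma AE_next_prob_le_1:
  assumes "e \<in> edges M"
  shows "AE \<sigma> in \<Lambda>. \<bar>next_prob e \<sigma>\<bar> \<le> 1"
  using AE_tendsto_next_prob(1)[OF assms]
proof eventually_elim
  case (elim \<sigma>)
  show ?case
    by (rule LIMSEQ_le_const2[OF tendsto_rabs[OF elim]]) (use abs_prb_le[OF assms] in auto)
qed

lemma integrable_next_prob: "e \<in> edges M \<Longrightarrow> integrable \<Lambda> (next_prob e)"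
  using AE_next_prob_le_1 by (intro L.integrable_const_bound[where B=1]) auto

lemma next_letter_sets [measurable]: "cylinder M 1 1 (\<lambda>_. Some e) \<in> sets \<Lambda>"
proof -
  have "cylinder M 1 1 (\<lambda>_. Some e) = window 1 1 -` {[Some e]} \<inter> space \<Lambda>"
    by (auto simp: cylinder_def space_\<Lambda> window_def)
  then show ?thesis using measurable_sets[OF window_measurable] by simp
qed

text \<open>By stationarity the left-hand side is the probability that \<open>e\<close> follows the word \<open>u\<close>, which is the limit
of the weights at the recalled points; dominated convergence identifies that limit with the right-hand side.\<close>

lemma next_letter_on_word:
  assumes e: "e \<in> edges M"
  shows "(\<integral>\<sigma>. indicator {u} (window 0 n \<sigma>) * indicator (cylinder M 1 1 (\<lambda>_. Some e)) \<sigma> \<partial>\<Lambda>) =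
    (\<integral>\<sigma>. indicator {u} (window 0 n \<sigma>) * next_prob e \<sigma> \<partial>\<Lambda>)"
proof (cases "\<exists>w. u = map Some w \<and> length w = n")
  case False
  have "AE \<sigma> in \<Lambda>. window 0 n \<sigma> \<noteq> u"
    by (rule AE_window[where Q="\<lambda>v. v \<noteq> u", THEN iffD2]) (use False length_q in blast)
  then have "AE \<sigma> in \<Lambda>. indicator {u} (window 0 n \<sigma>) = (0::real)" by eventually_elim simp
  then have "AE \<sigma> in \<Lambda>. indicator {u} (window 0 n \<sigma>) * f \<sigma> = (0::real)" for f
    by eventually_elim simp
  then show ?thesis by (simp add: integral_eq_zero_AE)
next
  case True
  then obtain w where w: "u = map Some w" "length w = n" by blast
  have "(\<integral>\<sigma>. indicator {u} (window 0 n \<sigma>) * indicator (cylinder M 1 1 (\<lambda>_. Some e)) \<sigma> \<partial>\<Lambda>)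
      = (\<integral>\<sigma>. (indicator {Some e # u} (window 1 (Suc n) \<sigma>) :: real) \<partial>\<Lambda>)"
    by (rule Bochner_Integration.integral_cong[OF refl])
       (auto simp: indicator_def cylinder_def window_Suc space_\<Lambda>)
  also have "\<dots> = measure_pmf.expectation (q (Suc n)) (indicator {e # w})"
    unfolding integral_window
    by (rule Bochner_Integration.integral_cong[OF refl])
       (auto simp: indicator_def w(1) map_eq_Cons_conv inj_map_eq_map)
  finally have lhs: "(\<integral>\<sigma>. indicator {u} (window 0 n \<sigma>) * indicator (cylinder M 1 1 (\<lambda>_. Some e)) \<sigma> \<partial>\<Lambda>) = pmf (q (Suc n)) (e # w)"
    by (simp add: measure_pmf_single)
  \<comment> \<open>The backward orbit at time \<open>l\<close> uses \<open>Suc l\<close> edges.\<close>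
  let ?s = "\<lambda>l \<sigma>. indicator {u} (window 0 n \<sigma>) * prb M e (backward_point (map the (window 0 (Suc l) \<sigma>)))"
  have "(\<lambda>l. \<integral>\<sigma>. ?s l \<sigma> \<partial>\<Lambda>) \<longlonglongrightarrow> (\<integral>\<sigma>. indicator {u} (window 0 n \<sigma>) * next_prob e \<sigma> \<partial>\<Lambda>)"
  proof (rule integral_dominated_convergence[where w="\<lambda>_. 1"])
    show "?s l \<in> borel_measurable \<Lambda>" for l
      by (intro borel_measurable_times measurable_compose[OF window_measurable]) auto
    show "(\<lambda>\<sigma>. indicator {u} (window 0 n \<sigma>) * next_prob e \<sigma>) \<in> borel_measurable \<Lambda>"
      by (intro borel_measurable_times measurable_compose[OF window_measurable] next_prob_measurable_\<Lambda>) auto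
    show "AE \<sigma> in \<Lambda>. (\<lambda>l. ?s l \<sigma>) \<longlonglongrightarrow> indicator {u} (window 0 n \<sigma>) * next_prob e \<sigma>"
      using AE_tendsto_next_prob(1)[OF e] by eventually_elim (intro tendsto_intros)
    show "AE \<sigma> in \<Lambda>. norm (?s l \<sigma>) \<le> 1" for l
      using abs_prb_le[OF e] by (auto simp: indicator_def)
  qed simp
  moreover have "(\<lambda>l. \<integral>\<sigma>. ?s l \<sigma> \<partial>\<Lambda>) \<longlonglongrightarrow> pmf (q (Suc n)) (e # w)"
  proof (rule Lim_transform_eventually)
    show "(\<lambda>l. measure_pmf.expectation (q (Suc l)) (\<lambda>v. indicator {w} (take (length w) v) * prb M e (backward_point v))) \<longlonglongrightarrow> pmf (q (Suc n)) (e # w)"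
      using LIMSEQ_Suc[OF next_edge_limit[OF e, of w]] w by simp
    show "\<forall>\<^sub>F l in sequentially. measure_pmf.expectation (q (Suc l)) (\<lambda>v. indicator {w} (take (length w) v) * prb M e (backward_point v)) = (\<integral>\<sigma>. ?s l \<sigma> \<partial>\<Lambda>)"
      using eventually_ge_at_top[of n]
    proof eventually_elim
      case (elim l)
      have "(\<integral>\<sigma>. ?s l \<sigma> \<partial>\<Lambda>) = (\<integral>\<sigma>. indicator {u} (take n (window 0 (Suc l) \<sigma>)) * prb M e (backward_point (map the (window 0 (Suc l) \<sigma>))) \<partial>\<Lambda>)"
        using elim by (simp add: take_window)
      also have "\<dots> = measure_pmf.expectation (q (Suc l)) (\<lambda>v. indicator {w} (take (length w) v) * prb M e (backward_point v))"
        unfolding integral_window[where f="\<lambda>v. indicator {u} (take n v) * prb M e (backward_point (map the v))"]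
        by (rule Bochner_Integration.integral_cong[OF refl])
           (auto simp: indicator_def w take_map inj_map_eq_map o_def)
      finally show ?case by simp
    qed
  qed
  ultimately have "(\<integral>\<sigma>. indicator {u} (window 0 n \<sigma>) * next_prob e \<sigma> \<partial>\<Lambda>) = pmf (q (Suc n)) (e # w)"
    by (rule LIMSEQ_unique)
  with lhs show ?thesis by (rule trans[OF _ sym])
qed

text \<open>The cylinders that end at time \<open>0\<close>, together with the empty set, form a generator stable under
intersections, so the identity extends from words to the whole past.\<close>

lemma next_letter_on_past:
  assumes e: "e \<in> edges M" and A: "A \<in> sets (past_algebra M)"
  shows "(LINT \<sigma>:A|\<Lambda>. indicator (cylinder M 1 1 (\<lambda>_. Some e)) \<sigma>) = (LINT \<sigma>:A|\<Lambda>. next_prob e \<sigma>)"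
proof -
  let ?\<Omega> = "topspace (code_space M)"
  let ?c = "indicator (cylinder M 1 1 (\<lambda>_. Some e)) :: (int \<Rightarrow> 'e option) \<Rightarrow> real"
  define gen where "gen = {cylinder M m 0 s | m s. m \<le> 0 \<and> (\<forall>k\<in>{m..0}. s k \<in> topspace (alphabet M))}"
  \<comment> \<open>Two cylinders may be disjoint, and no cylinder is empty.\<close>
  define gens where "gens = insert {} gen"
  have sub: "sets (past_algebra M) \<subseteq> sets \<Lambda>" using subalgebra_past by (simp add: subalgebra_def)
  have intc: "integrable \<Lambda> ?c"
    by (rule L.integrable_const_bound[where B=1]) (auto simp: indicator_def)
  have set_int: "set_integrable \<Lambda> D f" if "D \<in> sets \<Lambda>" "integrable \<Lambda> f" for D and f :: "_ \<Rightarrow> real"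
    unfolding set_integrable_def using that by (rule integrable_mult_indicator)
  have past: "sets (past_algebra M) = sigma_sets ?\<Omega> gen"
    unfolding past_algebra_def gen_def using past_algebra_generator by (rule sets_measure_of)
  have "sigma_sets ?\<Omega> gen = sigma_sets ?\<Omega> gens"
  proof (rule sigma_sets_eqI)
    fix B assume "B \<in> gens"
    then show "B \<in> sigma_sets ?\<Omega> gen" by (auto simp: gens_def intro: sigma_sets.Empty sigma_sets.Basic)
  qed (auto simp: gens_def)
  with past have pastG: "sets (past_algebra M) = sigma_sets ?\<Omega> gens" by simp
  have word: "(LINT \<sigma>:{\<sigma> \<in> ?\<Omega>. window 0 n \<sigma> = u}|\<Lambda>. ?c \<sigma>) = (LINT \<sigma>:{\<sigma> \<in> ?\<Omega>. window 0 n \<sigma> = u}|\<Lambda>. next_prob e \<sigma>)" for n u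
  proof -
    have "(LINT \<sigma>:{\<sigma> \<in> ?\<Omega>. window 0 n \<sigma> = u}|\<Lambda>. f \<sigma>) = (\<integral>\<sigma>. indicator {u} (window 0 n \<sigma>) * f \<sigma> \<partial>\<Lambda>)" for f :: "_ \<Rightarrow> real"
      unfolding set_lebesgue_integral_def
      by (rule Bochner_Integration.integral_cong) (auto simp: indicator_def space_\<Lambda>)
    then show ?thesis using next_letter_on_word[OF e, of u n] by simp
  qed
  \<comment> \<open>The whole space is not a cylinder, but it is the set of sequences that carry the empty word.\<close>
  have total: "(LINT \<sigma>:?\<Omega>|\<Lambda>. ?c \<sigma>) = (LINT \<sigma>:?\<Omega>|\<Lambda>. next_prob e \<sigma>)"
    using word[of 0 "[]"] by simp
  have "Int_stable gens"
  proof (rule Int_stableI)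
    fix B D assume "B \<in> gens" "D \<in> gens"
    have cyl: "cylinder M m 0 s \<inter> cylinder M m' 0 s' \<in> gens"
      if "m \<le> m'" "m' \<le> 0" "\<forall>k\<in>{m..0}. s k \<in> topspace (alphabet M)" for m m' s s'
    proof (cases "\<forall>k\<in>{m'..0}. s k = s' k")
      case True
      then have "cylinder M m 0 s \<inter> cylinder M m' 0 s' = cylinder M m 0 s"
        using that by (auto simp: cylinder_def)
      moreover have "cylinder M m 0 s \<in> gen" using that unfolding gen_def by fastforce
      ultimately show ?thesis by (simp add: gens_def)
    next
      case False
      then obtain k where "k \<in> {m'..0}" "s k \<noteq> s' k" by blast
      then have "cylinder M m 0 s \<inter> cylinder M m' 0 s' = {}"
        using that by (fastforce simp: cylinder_def)
      then show ?thesis by (simp add: gens_def)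
    qed
    consider "B = {} \<or> D = {}" | m s m' s' where "B = cylinder M m 0 s" "D = cylinder M m' 0 s'" "m \<le> 0" "m' \<le> 0"
        "\<forall>k\<in>{m..0}. s k \<in> topspace (alphabet M)" "\<forall>k\<in>{m'..0}. s' k \<in> topspace (alphabet M)"
      using \<open>B \<in> gens\<close> \<open>D \<in> gens\<close> unfolding gens_def gen_def by blast
    then show "B \<inter> D \<in> gens"
    proof cases
      case 2
      then show ?thesis
        using cyl[of m m' s s'] cyl[of m' m s' s] by (cases "m \<le> m'") (auto simp: Int_commute)
    qed (auto simp: gens_def)
  qed
  moreover have "gens \<subseteq> Pow ?\<Omega>"
    using past_algebra_generator by (auto simp: gens_def gen_def)
  moreover have "A \<in> sigma_sets ?\<Omega> gens" using A pastG by simp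
  ultimately show ?thesis
  proof (induction rule: sigma_sets_induct_disjoint)
    case (basic B)
    then consider "B = {}" | m s where "B = cylinder M m 0 s" "m \<le> 0"
      by (auto simp: gens_def gen_def)
    then show ?case
    proof cases
      case 1
      then show ?thesis by (simp add: set_lebesgue_integral_def)
    next
      case 2
      then show ?thesis by (simp add: cylinder_window word)
    qed
  next
    case (compl B)
    then have B: "B \<in> sets \<Lambda>" "B \<subseteq> ?\<Omega>"
      using sub pastG sigma_sets_into_sp[OF \<open>gens \<subseteq> Pow ?\<Omega>\<close>] by auto
    have "(LINT \<sigma>:?\<Omega> - B|\<Lambda>. f \<sigma>) = (LINT \<sigma>:?\<Omega>|\<Lambda>. f \<sigma>) - (LINT \<sigma>:B|\<Lambda>. f \<sigma>)" if "integrable \<Lambda> f" for f :: "_ \<Rightarrow> real"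
    proof -
      have \<Omega>: "?\<Omega> \<in> sets \<Lambda>" using sets.top[of \<Lambda>] by (simp add: space_\<Lambda>)
      have "(LINT \<sigma>:(?\<Omega> - B) \<union> B|\<Lambda>. f \<sigma>) = (LINT \<sigma>:?\<Omega> - B|\<Lambda>. f \<sigma>) + (LINT \<sigma>:B|\<Lambda>. f \<sigma>)"
        using that B(1) \<Omega> by (intro set_integral_Un) (auto intro!: set_int)
      moreover have "(?\<Omega> - B) \<union> B = ?\<Omega>" using B(2) by auto
      ultimately show ?thesis by simp
    qed
    then show ?case using intc integrable_next_prob[OF e] compl total by simp
  next
    case (union B)
    then have B: "\<And>i. B i \<in> sets \<Lambda>" using sub pastG by auto
    have "(LINT \<sigma>:(\<Union>i. B i)|\<Lambda>. f \<sigma>) = (\<Sum>i. (LINT \<sigma>:B i|\<Lambda>. f \<sigma>))" if "integrable \<Lambda> f" for f :: "_ \<Rightarrow> real"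
      using that B union(1) by (intro lebesgue_integral_countable_add)
        (auto simp: disjoint_family_on_def intro!: set_int)
    then show ?case using intc integrable_next_prob[OF e] union by simp
  qed (simp add: set_lebesgue_integral_def)
qed

lemma equilibrium: "\<Lambda> \<in> equilibrium_probs M x"
proof -
  interpret sigma_finite_subalgebra \<Lambda> "past_algebra M"
    by (intro finite_measure_subalgebra_is_sigma_finite) (unfold_locales, rule subalgebra_past)
  have "emeasure \<Lambda> (coding_dom M x) = 1"
    by (rule L.emeasure_eq_1_AE) (use AE_coding_dom coding_dom_sets in \<open>auto simp: sets_\<Lambda>\<close>)
  moreover have "AE \<sigma> in \<Lambda>. real_cond_exp \<Lambda> (past_algebra M) (indicator (cylinder M 1 1 (\<lambda>_. Some e))) \<sigma> =
             prb_closure M e (coding_map M x \<sigma>) * indicator (paths_ending M (ini M e)) \<sigma>" if e: "e \<in> edges M" for e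
  proof -
    have "AE \<sigma> in \<Lambda>. real_cond_exp \<Lambda> (past_algebra M) (indicator (cylinder M 1 1 (\<lambda>_. Some e))) \<sigma> = next_prob e \<sigma>"
      by (rule real_cond_exp_charact[OF next_letter_on_past[OF e]])
         (use integrable_next_prob[OF e] next_prob_measurable in
           \<open>auto intro!: L.integrable_const_bound[where B=1] simp: indicator_def\<close>)
    with AE_tendsto_next_prob(2)[OF e] show ?thesis by eventually_elim simp
  qed
  ultimately show ?thesis using invariant by (simp add: equilibrium_probs_def)
qed

end

theorem corollary3:
  fixes M :: "('a::complete_space, 'e) markov_system"
    and x :: "nat \<Rightarrow> 'a"
  assumes "countable_markov_system M"
    and "\<forall>i\<in>verts M. x i \<in> cell M i"
    and "consistent M x"
    and "contractive M"
    and "uniformly_continuous_system M"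
    and "base_const M x < \<infinity>"
    and "has_dominating_chain M"
    and "dom_const M < \<infinity>"
  shows "invariant_probs M \<noteq> {}"
proof -
  interpret coded_system M x using assms by unfold_locales auto
  obtain a where a: "0 < a" "a < 1" "contractive_with_rate M a"
    using assms(4) by (auto simp: contractive_def)
  obtain C where C: "0 \<le> C" "\<And>l k. l \<le> k \<Longrightarrow> gap l k \<le> ennreal (C * a ^ l)"
    using gap_bound[OF a(3,1,2) assms(6)] by blast
  obtain q G where q: "limit_words M x q G"
    using limit_words_exist[OF assms(7,8)] by blast
  interpret q: limit_words M x q G by (rule q)
  obtain \<Lambda> where \<Lambda>: "\<Lambda> \<in> shift_invariant_probs M"
    "\<And>n l. distr \<Lambda> (count_space UNIV) (window n l) = measure_pmf (map_pmf (map Some) (q l))"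
    using q.code_law_exists by blast
  interpret code_law M x q G a C \<Lambda>
    by unfold_locales (use a C assms(5) \<Lambda> in auto)
  have "distr \<Lambda> borel (coding_map M x) \<in> invariant_probs M"
    using assms(3) equilibrium by (auto simp: consistent_def)
  then show ?thesis by blast
qed

end
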